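(* Let $\mathbb{K}$ be a field, $S=\mathbb{K}[x_1,\ldots,x_n]$, and let $m=x_{i_1}\cdots x_{i_s}\in S$ be a square-free monomial with $1\le i_1<\cdots<i_s\le n$. Let $T(m)=(t_k,\ldots,t_0)$ and suppose that $i_{t_k}<s$. Let $T'(m)=(t_{k_r},\ldots,t_{k_1})$, let $l$ be the largest index in $\{0,\ldots,k\}$ such that $i_{t_{k_1}}+1\leq t_l$, and let $I=\mathrm{sfBorel}(m)$. If $T'(m)$ is a truncation of $T(m)$ and there is no $t_p\in T(m)$ such that $t_{k_1}<t_p<t_l$, then $$\widehat{\alpha}(I)= 1+\frac{s-i_{t_{k_1}}-1}{i_{t_l}-t_l+1}+\frac{i_{t_k}}{i_{t_{k}}-t_k+1}+\sum_{j=1}^{r-1}\frac{i_{t_{k_j}}-i_{t_{k_{j+1}}}}{i_{t_{k_j}}-t_{k_{j}}+1}.$$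
   Context: Square-free principal Borel ideal. For a monomial $m$, a Borel move of $m$ is a monomial $m\cdot\frac{x_{a_1}}{x_{b_1}}\cdots\frac{x_{a_q}}{x_{b_q}}$ with $a_p<b_p$ and $x_{b_p}\mid m$ for all $p$ (the trivial move giving $m$ itself is allowed). For a square-free monomial $m$, $\mathrm{sfBorel}(m)$ is the ideal of $S$ generated by all square-free monomials that are Borel moves of $m$; equivalently, for $m=x_{i_1}\cdots x_{i_s}$ with $i_1<\cdots<i_s$, it is generated by all $x_{j_1}\cdots x_{j_s}$ with $j_1<\cdots<j_s$ and $j_p\le i_p$ for all $p$. Waldschmidt constant. For a square-free monomial ideal $L\subseteq S$ with minimal primary decomposition $L=P_1\cap\cdots\cap P_t$ (the $P_i$ prime), the $q$-th symbolic power is $L^{(q)}=P_1^q\cap\cdots\cap P_t^q$. Write $\alpha(J)$ for the smallest degree of a generator of a homogeneous ideal $J$. Then $\widehat{\alpha}(L)=\lim_{q\to\infty}\alpha(L^{(q)})/q$. The tuple $T(m)$. For $m=x_{i_1}\cdots x_{i_s}$ with $i_1<\cdots<i_s$, put $t_0=s$ and, once $t_{q-1}$ is defined, put $t_q=\max\{j: 1\le j<t_{q-1},\ i_j<i_{j+1}-1\}$, stopping when this set is empty; the last one defined is $t_k$. Write $T(m)=(t_k,\ldots,t_0)$, so $t_k<t_{k-1}<\cdots<t_0=s$. The subsequence $T'(m)$ (defined when $i_{t_k}<s$). Define elements $t_1'<t_2'<\cdots<t_r'$ of $T(m)$ inductively: $t_1'=t_k$; given $t_j'$, let $t_{j+1}'$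 be the smallest element $t$ of $T(m)$ such that $i_{t_j'}<t$ and $i_t\le s-1$, stopping if there is none. So $i_{t_j'}\le s-1$ for all $1\le j\le r$. One writes $T'(m)=(t_{k_r},\ldots,t_{k_1})$ where $t_{k_j}=t'_{r-j+1}$; thus $t_{k_r}=t_k$ and $t_{k_r}<\cdots<t_{k_1}$. Since $i_{t_{k_1}}+1\le s=t_0$, an index $l$ with $i_{t_{k_1}}+1\le t_l$ exists. Truncation. $T'(m)$ is a truncation of $T(m)$ if it is an initial segment of it, i.e. $T'(m)=(t_k,t_{k-1},\ldots,t_{k-r+1})$. *)

theory Defs
  imports
    Complex_Main
    "HOL-Library.Poly_Mapping"
    "HOL-Library.Sublist"
    "HOL-Algebra.Ideal_Product"
begin

section \<open>Polynomial rings, degrees, and monomials\<close>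

text \<open>A monomial is its exponent vector; variable indices start at \<open>1\<close>.\<close>

type_synonym mon = "nat \<Rightarrow>\<^sub>0 nat"
type_synonym 'k mpol = "(nat \<Rightarrow>\<^sub>0 nat) \<Rightarrow>\<^sub>0 'k"

text \<open>\<open>K[x\<^sub>1, \<dots>, x\<^sub>n]\<close> is cut out of the polynomial ring in countably many variables,
  so that \<open>n\<close> can be an ordinary natural number.\<close>

definition mpoly_ring :: "nat \<Rightarrow> 'k::field mpol ring" where
  "mpoly_ring n =
    \<lparr>carrier = {p. \<forall>t \<in> Poly_Mapping.keys p. Poly_Mapping.keys t \<subseteq> {1..n}},
     mult = (*), one = 1, zero = 0, add = (+)\<rparr>"

definition mon_deg :: "mon \<Rightarrow> nat" where
  "mon_deg t = (\<Sum>v \<in> Poly_Mapping.keys t. Poly_Mapping.lookup t v)"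

definition squarefree_mon :: "mon \<Rightarrow> bool" where
  "squarefree_mon t \<longleftrightarrow> (\<forall>v. Poly_Mapping.lookup t v \<le> 1)"

definition mon_poly :: "mon \<Rightarrow> 'k::field mpol" where
  "mon_poly t = Poly_Mapping.single t 1"

definition homogeneous_of_degree :: "nat \<Rightarrow> 'k::field mpol \<Rightarrow> bool" where
  "homogeneous_of_degree d p \<longleftrightarrow> (\<forall>t \<in> Poly_Mapping.keys p. mon_deg t = d)"

section \<open>Square-free principal Borel ideals\<close>

text \<open>The fraction is cleared: \<open>m' = m \<cdot> (x\<^bsub>a\<^sub>1\<^esub> / x\<^bsub>b\<^sub>1\<^esub>) \<cdots> (x\<^bsub>a\<^sub>q\<^esub> / x\<^bsub>b\<^sub>q\<^esub>)\<close> becomes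
  \<open>m' \<cdot> \<Prod> x\<^bsub>b\<^sub>p\<^esub> = m \<cdot> \<Prod> x\<^bsub>a\<^sub>p\<^esub>\<close>, written additively in the exponents.
  The list \<open>ps\<close> consists of the pairs \<open>(a\<^sub>p, b\<^sub>p)\<close>; the empty list is the trivial move.\<close>

definition borel_move :: "mon \<Rightarrow> mon \<Rightarrow> bool" where
  "borel_move m m' \<longleftrightarrow>
    (\<exists>ps :: (nat \<times> nat) list.
      (\<forall>(a, b) \<in> set ps. 1 \<le> a \<and> a < b \<and> 1 \<le> Poly_Mapping.lookup m b) \<and>
      m' + (\<Sum>(a, b) \<leftarrow> ps. Poly_Mapping.single b 1)
        = m + (\<Sum>(a, b) \<leftarrow> ps. Poly_Mapping.single a 1))"

definition sfBorel :: "nat \<Rightarrow> mon \<Rightarrow> 'k::field mpol set" where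
  "sfBorel n m =
    genideal (mpoly_ring n) {mon_poly m' | m'. squarefree_mon m' \<and> borel_move m m'}"

section \<open>Symbolic powers and the Waldschmidt constant\<close>

definition prime_decomp_of :: "('a, 'b) ring_scheme \<Rightarrow> 'a set \<Rightarrow> 'a set set \<Rightarrow> bool" where
  "prime_decomp_of R L \<P> \<longleftrightarrow>
    finite \<P> \<and> (\<forall>P \<in> \<P>. primeideal P R) \<and> carrier R \<inter> \<Inter>\<P> = L"

text \<open>A minimal primary decomposition with prime components, that is, an irredundant one.
  The radicals of distinct components are automatically distinct. Such a decomposition is
  unique when it exists, as it does for square-free monomial ideals.\<close>

definition minimal_prime_decomp_of :: "('a, 'b) ring_scheme \<Rightarrow> 'a set \<Rightarrow> 'a set set \<Rightarrow> bool" where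
  "minimal_prime_decomp_of R L \<P> \<longleftrightarrow>
    prime_decomp_of R L \<P> \<and> (\<forall>P \<in> \<P>. carrier R \<inter> \<Inter>(\<P> - {P}) \<noteq> L)"

definition symbolic_power :: "('a, 'b) ring_scheme \<Rightarrow> 'a set \<Rightarrow> nat \<Rightarrow> 'a set" where
  "symbolic_power R L q =
    carrier R \<inter> (\<Inter>P \<in> (THE \<P>. minimal_prime_decomp_of R L \<P>). P [^]\<^bsub>ideals_set R\<^esub> q)"

definition homogeneous_generators :: "nat \<Rightarrow> 'k::field mpol set \<Rightarrow> 'k mpol set \<Rightarrow> bool" where
  "homogeneous_generators n J G \<longleftrightarrow>
    G \<subseteq> carrier (mpoly_ring n) - {0} \<and> (\<forall>g \<in> G. \<exists>d. homogeneous_of_degree d g) \<and>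
    genideal (mpoly_ring n) G = J"

text \<open>The smallest degree of a generator does not depend on the generating system, so the
  least degree over all systems of nonzero homogeneous generators is taken. For \<open>J = 0\<close> the
  value is unspecified.\<close>

definition alpha :: "nat \<Rightarrow> 'k::field mpol set \<Rightarrow> nat" where
  "alpha n J = (LEAST d. \<exists>G. homogeneous_generators n J G \<and> (\<exists>g \<in> G. homogeneous_of_degree d g))"

definition waldschmidt_seq :: "nat \<Rightarrow> 'k::field mpol set \<Rightarrow> nat \<Rightarrow> real" where
  "waldschmidt_seq n L q = real (alpha n (symbolic_power (mpoly_ring n) L q)) / real q"

definition waldschmidt :: "nat \<Rightarrow> 'k::field mpol set \<Rightarrow> real" where
  "waldschmidt n L = lim (waldschmidt_seq n L)"

section \<open>The tuples \<open>T(m)\<close> and \<open>T'(m)\<close>\<close>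

text \<open>The monomial \<open>m = x\<^bsub>i\<^sub>1\<^esub> \<cdots> x\<^bsub>i\<^sub>s\<^esub>\<close> enters through the index sequence \<open>i\<close>
  (only \<open>i 1, \<dots>, i s\<close> matter) and its length \<open>s\<close>.\<close>

definition sf_mon :: "(nat \<Rightarrow> nat) \<Rightarrow> nat \<Rightarrow> mon" where
  "sf_mon i s = (\<Sum>j = 1..s. Poly_Mapping.single (i j) 1)"

definition T_cand :: "(nat \<Rightarrow> nat) \<Rightarrow> nat \<Rightarrow> nat set" where
  "T_cand i t = {j. 1 \<le> j \<and> j < t \<and> i j < i (j + 1) - 1}"

text \<open>\<open>T_entry i s q\<close> is \<open>t\<^sub>q\<close>; only the values for \<open>q \<le> T_last i s\<close>, the index \<open>k\<close> at which
  the construction stops, are meaningful.\<close>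

primrec T_entry :: "(nat \<Rightarrow> nat) \<Rightarrow> nat \<Rightarrow> nat \<Rightarrow> nat" where
  "T_entry i s 0 = s"
| "T_entry i s (Suc q) = Max (T_cand i (T_entry i s q))"

definition T_last :: "(nat \<Rightarrow> nat) \<Rightarrow> nat \<Rightarrow> nat" where
  "T_last i s = (LEAST q. T_cand i (T_entry i s q) = {})"

definition T_list :: "(nat \<Rightarrow> nat) \<Rightarrow> nat \<Rightarrow> nat list" where
  "T_list i s = rev (map (T_entry i s) [0..<T_last i s + 1])"

definition T'_cand :: "(nat \<Rightarrow> nat) \<Rightarrow> nat \<Rightarrow> nat \<Rightarrow> nat set" where
  "T'_cand i s t' = {t \<in> set (T_list i s). i t' < t \<and> i t \<le> s - 1}"

text \<open>\<open>T'_entry i s j\<close> is \<open>t'\<^bsub>j+1\<^esub>\<close> (the index is shifted to start at \<open>0\<close>).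
  It is meaningful for \<open>j < T'_length i s\<close>, the number \<open>r\<close> of entries.\<close>

primrec T'_entry :: "(nat \<Rightarrow> nat) \<Rightarrow> nat \<Rightarrow> nat \<Rightarrow> nat" where
  "T'_entry i s 0 = T_entry i s (T_last i s)"
| "T'_entry i s (Suc j) = Min (T'_cand i s (T'_entry i s j))"

definition T'_length :: "(nat \<Rightarrow> nat) \<Rightarrow> nat \<Rightarrow> nat" where
  "T'_length i s = Suc (LEAST j. T'_cand i s (T'_entry i s j) = {})"

definition T'_list :: "(nat \<Rightarrow> nat) \<Rightarrow> nat \<Rightarrow> nat list" where
  "T'_list i s = map (T'_entry i s) [0..<T'_length i s]"

text \<open>\<open>T'_rev_entry i s j\<close> is \<open>t\<^bsub>k\<^sub>j\<^esub> = t'\<^bsub>r-j+1\<^esub>\<close>, for \<open>1 \<le> j \<le> r\<close>.\<close>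

definition T'_rev_entry :: "(nat \<Rightarrow> nat) \<Rightarrow> nat \<Rightarrow> nat \<Rightarrow> nat" where
  "T'_rev_entry i s j = T'_entry i s (T'_length i s - j)"

end

theory Submission
  imports Defs
begin

text \<open>
  The Waldschmidt constant of a square-free monomial ideal \<open>L = P\<^sub>1 \<inter> \<dots> \<inter> P\<^sub>t\<close>, where \<open>P\<^sub>j\<close> is
  generated by the variables in \<open>B\<^sub>j\<close>, is the optimum of a linear program: minimise
  \<open>y\<^sub>1 + \<dots> + y\<^sub>n\<close> over \<open>y \<ge> 0\<close> with \<open>y(B\<^sub>j) \<ge> 1\<close> for all \<open>j\<close>. Indeed a monomial lies in
  \<open>L\<^sup>(\<^sup>q\<^sup>)\<close> iff its exponents sum to at least \<open>q\<close> over every \<open>B\<^sub>j\<close>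
  (\<open>symbolic_power_eq\<close>), so \<open>\<alpha>(L\<^sup>(\<^sup>q\<^sup>)) / q\<close> is at least the optimum, and rounding up \<open>q y\<close> for an
  optimal \<open>y\<close> shows that it exceeds the optimum by at most \<open>n / q\<close>
  (\<open>waldschmidt_eq_fractional_cover\<close>).

  For \<open>L = sfBorel(m)\<close>, a monomial belongs to \<open>L\<close> iff its support has at least \<open>p\<close> elements in
  \<open>{1..i\<^sub>p}\<close> for every \<open>p\<close>, that is, iff the support meets every \<open>B \<subseteq> {1..i\<^sub>p}\<close> of size
  \<open>c\<^sub>p = i\<^sub>p - p + 1\<close> (\<open>sfBorel_eq_cover_ideal\<close>). The condition at \<open>p\<close> follows from the one at the
  next entry of \<open>T(m)\<close>, since \<open>c\<close> is constant along runs of consecutive indices.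

  Let \<open>v\<^sub>0 < \<dots> < v\<^bsub>r-1\<^esub>\<close> be the entries of \<open>T'(m)\<close> in increasing order, put \<open>a = i\<^sub>v\<close> for
  \<open>v = v\<^bsub>r-1\<^esub>\<close>, and write \<open>w\<close> for \<open>t\<^sub>l\<close>. The stated value is the total mass of the weakly
  decreasing step function equal to \<open>1 / c\<close> at \<open>v\<^sub>j\<close> on the indices after \<open>i\<close> at \<open>v\<^bsub>j-1\<^esub>\<close> (from \<open>1\<close> on,
  if \<open>j = 0\<close>) up to \<open>i\<close> at \<open>v\<^sub>j\<close>, to
  \<open>1 / c\<^sub>w\<close> on the next \<open>s + c\<^sub>w - 1 - a\<close> indices, and to \<open>0\<close> afterwards. It is feasible
  (\<open>height_fractional_cover\<close>): the constraint at \<open>v\<^sub>j\<close> only sees values of at least \<open>1 / c\<close> at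
  \<open>v\<^sub>j\<close>, and for \<open>t \<ge> w\<close> at most \<open>c\<^sub>t - c\<^sub>w\<close> elements of a block can fall where the function
  vanishes. Truncation together with the absence of entries strictly between \<open>v\<^bsub>r-1\<^esub>\<close> and \<open>w\<close>
  says that \<open>T(m)\<close> has only entries of these two kinds.

  It is optimal (\<open>area_le_cover\<close>): the steps of \<open>T'(m)\<close> are so long that each of them contains a
  whole block for its \<open>v\<^sub>j\<close>, so by averaging over blocks every feasible \<open>y\<close> has at least the
  claimed mass on each step. Beyond \<open>a\<close>, averaging for \<open>w\<close> yields \<open>s - 1 - a\<close> indices of mass at
  least \<open>(s - 1 - a) / c\<^sub>w\<close>; the remaining indices up to \<open>i\<^sub>s\<close> number exactly \<open>c\<^sub>s\<close> and carry mass
  at least \<open>1\<close>.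
\<close>

section \<open>Monomial ideals\<close>

abbreviation mlookup :: "('a \<Rightarrow>\<^sub>0 'b::zero) \<Rightarrow> 'a \<Rightarrow> 'b" where
  "mlookup \<equiv> Poly_Mapping.lookup"

abbreviation mkeys :: "('a \<Rightarrow>\<^sub>0 'b::zero) \<Rightarrow> 'a set" where
  "mkeys \<equiv> Poly_Mapping.keys"

definition monomials :: "nat \<Rightarrow> mon set" where
  "monomials n = {t. mkeys t \<subseteq> {1..n}}"

lemma mkeys_mon_add: "mkeys (t + u) = mkeys t \<union> mkeys (u::mon)"
  by (auto simp: in_keys_iff lookup_add)

lemma monomials_add: "t \<in> monomials n \<Longrightarrow> u \<in> monomials n \<Longrightarrow> t + u \<in> monomials n"
  by (simp add: monomials_def mkeys_mon_add)

lemma carrier_mpoly_ring: "carrier (mpoly_ring n) = {p. mkeys p \<subseteq> monomials n}"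
  by (auto simp: mpoly_ring_def monomials_def)

lemma mpoly_ring_simps [simp]:
  "x \<otimes>\<^bsub>mpoly_ring n\<^esub> y = x * y" "x \<oplus>\<^bsub>mpoly_ring n\<^esub> y = x + y"
  "\<one>\<^bsub>mpoly_ring n\<^esub> = 1" "\<zero>\<^bsub>mpoly_ring n\<^esub> = 0"
  by (simp_all add: mpoly_ring_def)

lemma add_in_carrier: "p \<in> carrier (mpoly_ring n) \<Longrightarrow> q \<in> carrier (mpoly_ring n) \<Longrightarrow>
    p + q \<in> carrier (mpoly_ring n)"
  using Poly_Mapping.keys_add[of p q] by (auto simp: carrier_mpoly_ring)

lemma mult_in_carrier: "p \<in> carrier (mpoly_ring n) \<Longrightarrow> q \<in> carrier (mpoly_ring n) \<Longrightarrow>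
    p * q \<in> carrier (mpoly_ring n)"
  using keys_mult[of p q] monomials_add by (auto simp: carrier_mpoly_ring) blast

lemma keys_uminus_field: "mkeys (- p) = mkeys (p :: 'k::field mpol)"
  by (auto simp: in_keys_iff)

lemma cring_mpoly_ring: "cring (mpoly_ring n :: 'k::field mpol ring)"
proof (rule cringI)
  show "abelian_group (mpoly_ring n :: 'k mpol ring)"
  proof (rule abelian_groupI)
    fix x :: "'k mpol" assume "x \<in> carrier (mpoly_ring n)"
    then have "- x \<in> carrier (mpoly_ring n)" by (simp add: carrier_mpoly_ring keys_uminus_field)
    then show "\<exists>y\<in>carrier (mpoly_ring n). y \<oplus>\<^bsub>mpoly_ring n\<^esub> x = \<zero>\<^bsub>mpoly_ring n\<^esub>" by force
  qed (simp_all add: add_in_carrier add.assoc add.commute, simp add: carrier_mpoly_ring)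
  show "Group.comm_monoid (mpoly_ring n :: 'k mpol ring)"
    by (rule comm_monoidI)
       (simp_all add: mult_in_carrier mult.assoc mult.commute, simp add: carrier_mpoly_ring monomials_def)
qed (simp add: distrib_right)

lemma poly_eq_sum_terms: "(\<Sum>t\<in>mkeys p. Poly_Mapping.single t (mlookup p t)) = p"
  by (rule poly_mapping_eqI) (simp add: lookup_sum lookup_single when_def in_keys_iff)

definition mon_ideal :: "nat \<Rightarrow> mon set \<Rightarrow> 'k::field mpol set" where
  "mon_ideal n M = {p \<in> carrier (mpoly_ring n). mkeys p \<subseteq> M}"

definition absorbing :: "nat \<Rightarrow> mon set \<Rightarrow> bool" where
  "absorbing n M \<longleftrightarrow> (\<forall>t \<in> M. \<forall>u \<in> monomials n. t + u \<in> M)"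

lemma mon_ideal_add: "p \<in> mon_ideal n M \<Longrightarrow> q \<in> mon_ideal n M \<Longrightarrow> p + q \<in> mon_ideal n M"
  using Poly_Mapping.keys_add[of p q] by (auto simp: mon_ideal_def add_in_carrier)

lemma mon_ideal_mult:
  assumes "absorbing n M" "p \<in> mon_ideal n M" "q \<in> carrier (mpoly_ring n)"
  shows "p * q \<in> mon_ideal n M"
proof -
  have "t \<in> M" if t: "t \<in> mkeys (p * q)" for t
  proof -
    obtain u w where "t = u + w" "u \<in> mkeys p" "w \<in> mkeys q"
      using subsetD[OF keys_mult t] by blast
    then show ?thesis using assms by (auto simp: mon_ideal_def absorbing_def carrier_mpoly_ring)
  qed
  then show ?thesis using assms by (auto simp: mon_ideal_def mult_in_carrier)
qed

lemma ideal_mon_ideal: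
  assumes "absorbing n M"
  shows "ideal (mon_ideal n M :: 'k::field mpol set) (mpoly_ring n)"
proof (rule idealI)
  interpret cring "mpoly_ring n :: 'k mpol ring" by (rule cring_mpoly_ring)
  show "ring (mpoly_ring n :: 'k mpol ring)" by (rule ring_axioms)
  show "subgroup (mon_ideal n M) (add_monoid (mpoly_ring n :: 'k mpol ring))"
  proof (rule add.subgroupI)
    show "mon_ideal n M \<subseteq> carrier (mpoly_ring n)" by (auto simp: mon_ideal_def)
    have "0 \<in> mon_ideal n M" by (simp add: mon_ideal_def carrier_mpoly_ring)
    then show "mon_ideal n M \<noteq> ({} :: 'k mpol set)" by blast
    fix a :: "'k mpol" assume a: "a \<in> mon_ideal n M"
    then have c: "a \<in> carrier (mpoly_ring n)" "- a \<in> carrier (mpoly_ring n)"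
      by (auto simp: mon_ideal_def carrier_mpoly_ring keys_uminus_field)
    have "\<ominus>\<^bsub>mpoly_ring n\<^esub> a = - a" using minus_equality[of "- a" a] c by simp
    then show "\<ominus>\<^bsub>mpoly_ring n\<^esub> a \<in> mon_ideal n M" using a c
      by (simp add: mon_ideal_def keys_uminus_field)
    fix b :: "'k mpol" assume "b \<in> mon_ideal n M"
    then show "a \<oplus>\<^bsub>mpoly_ring n\<^esub> b \<in> mon_ideal n M" using a by (simp add: mon_ideal_add)
  qed
next
  fix a x :: "'k mpol"
  assume ax: "a \<in> mon_ideal n M" "x \<in> carrier (mpoly_ring n)"
  from mon_ideal_mult[OF assms ax]
  show "a \<otimes>\<^bsub>mpoly_ring n\<^esub> x \<in> mon_ideal n M" "x \<otimes>\<^bsub>mpoly_ring n\<^esub> a \<in> mon_ideal n M"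
    by (simp_all add: mult.commute)
qed

text \<open>A polynomial is the sum of its terms, so a set closed under sums that contains the terms
  contains the whole monomial ideal.\<close>

lemma mon_ideal_induct [consumes 1, case_names zero add single]:
  assumes "p \<in> mon_ideal n M" and "0 \<in> J"
    and add: "\<And>a b. a \<in> J \<Longrightarrow> b \<in> J \<Longrightarrow> a + b \<in> J"
    and tm: "\<And>t c. t \<in> M \<Longrightarrow> t \<in> monomials n \<Longrightarrow> Poly_Mapping.single t c \<in> J"
  shows "p \<in> J"
proof -
  have "(\<Sum>t\<in>F. Poly_Mapping.single t (mlookup p t)) \<in> J" if "finite F" "F \<subseteq> mkeys p" for F
    using that
  proof (induction F)
    case (insert t F)
    then have "t \<in> M \<inter> monomials n" using assms(1) by (auto simp: mon_ideal_def carrier_mpoly_ring)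
    then show ?case using insert add tm by simp
  qed (simp add: assms(2))
  from this[of "mkeys p"] show ?thesis by (simp add: poly_eq_sum_terms)
qed

lemma mon_ideal_subset_ideal:
  assumes J: "ideal J (mpoly_ring n)" and M: "\<And>t. t \<in> M \<Longrightarrow> t \<in> monomials n \<Longrightarrow> mon_poly t \<in> J"
  shows "mon_ideal n M \<subseteq> (J :: 'k::field mpol set)"
proof
  interpret ideal J "mpoly_ring n" by fact
  fix p :: "'k mpol" assume "p \<in> mon_ideal n M"
  then show "p \<in> J"
  proof (induction rule: mon_ideal_induct)
    case zero
    then show ?case using additive_subgroup.zero_closed[OF is_additive_subgroup] by simp
  next
    case (add a b) then show ?case using additive_subgroup.a_closed[OF is_additive_subgroup] by fastforce
  next
    case (single t c)
    have "Poly_Mapping.single 0 c \<in> carrier (mpoly_ring n)"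
      by (simp add: carrier_mpoly_ring monomials_def)
    from I_l_closed[OF M[OF single] this] show ?case by (simp add: mon_poly_def mult_single)
  qed
qed

lemma mon_poly_nonzero: "mon_poly t \<noteq> 0"
  unfolding mon_poly_def by (metis lookup_single_eq lookup_zero one_neq_zero)

lemma mon_poly_in_mon_ideal:
  "mon_poly t \<in> (mon_ideal n M :: 'k::field mpol set) \<longleftrightarrow> t \<in> M \<and> t \<in> monomials n"
  by (auto simp: mon_ideal_def mon_poly_def carrier_mpoly_ring)

text \<open>The smallest ideal containing \<open>G\<close> contains the multiples of its elements, hence, being closed
  under sums, all polynomials built from them.\<close>

lemma genideal_monomials:
  assumes "absorbing n M" and G: "G \<subseteq> M \<inter> monomials n"
    and div: "\<And>t. t \<in> M \<Longrightarrow> t \<in> monomials n \<Longrightarrow> \<exists>g\<in>G. \<exists>u\<in>monomials n. t = g + u"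
  shows "genideal (mpoly_ring n) (mon_poly ` G) = (mon_ideal n M :: 'k::field mpol set)"
proof
  interpret cring "mpoly_ring n :: 'k mpol ring" by (rule cring_mpoly_ring)
  show "genideal (mpoly_ring n) (mon_poly ` G) \<subseteq> (mon_ideal n M :: 'k mpol set)"
    using G by (intro genideal_minimal ideal_mon_ideal assms) (auto simp: mon_poly_in_mon_ideal)
  have Gc: "mon_poly ` G \<subseteq> carrier (mpoly_ring n :: 'k mpol ring)"
    using G by (auto simp: carrier_mpoly_ring mon_poly_def)
  show "mon_ideal n M \<subseteq> genideal (mpoly_ring n :: 'k mpol ring) (mon_poly ` G)"
  proof (rule mon_ideal_subset_ideal)
    show id: "ideal (genideal (mpoly_ring n :: 'k mpol ring) (mon_poly ` G)) (mpoly_ring n)"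
      by (rule genideal_ideal[OF Gc])
    fix t assume "t \<in> M" "t \<in> monomials n"
    from div[OF this] obtain g u where gu: "g \<in> G" "u \<in> monomials n" "t = g + u" by blast
    have "(mon_poly g :: 'k mpol) \<in> genideal (mpoly_ring n) (mon_poly ` G)"
      using genideal_self[OF Gc] gu(1) by blast
    moreover have "(mon_poly u :: 'k mpol) \<in> carrier (mpoly_ring n)"
      using gu(2) by (auto simp: carrier_mpoly_ring mon_poly_def)
    ultimately have "(mon_poly g * mon_poly u :: 'k mpol) \<in> genideal (mpoly_ring n) (mon_poly ` G)"
      using ideal.I_r_closed[OF id] by fastforce
    then show "(mon_poly t :: 'k mpol) \<in> genideal (mpoly_ring n) (mon_poly ` G)"
      by (simp add: gu(3) mon_poly_def mult_single)
  qed
qed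

section \<open>Ideals generated by variables\<close>

definition weight :: "nat set \<Rightarrow> mon \<Rightarrow> nat" where
  "weight B t = (\<Sum>v\<in>B. mlookup t v)"

lemma weight_add: "weight B (t + u) = weight B t + weight B u"
  by (simp add: weight_def lookup_add sum.distrib)

lemma weight_single: "finite B \<Longrightarrow> weight B (Poly_Mapping.single v c) = (if v \<in> B then c else 0)"
  by (simp add: weight_def lookup_single when_def)

lemma weight_zero [simp]: "weight B 0 = 0"
  by (simp add: weight_def)

text \<open>The \<open>q\<close>-th power of the prime ideal generated by the variables \<open>x\<^sub>v\<close> with \<open>v \<in> B\<close>,
  described through its monomials; \<open>power_vars\<close> identifies it with the ideal-theoretic power.\<close>

definition vars_power :: "nat \<Rightarrow> nat set \<Rightarrow> nat \<Rightarrow> 'k::field mpol set" where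
  "vars_power n B q = mon_ideal n {t. q \<le> weight B t}"

lemma absorbing_weight: "absorbing n {t. q \<le> weight B t}"
  by (simp add: absorbing_def weight_add)

lemma ideal_vars_power: "ideal (vars_power n B q) (mpoly_ring n)"
  unfolding vars_power_def by (rule ideal_mon_ideal[OF absorbing_weight])

text \<open>Modulo this ideal each polynomial is congruent to its part free of the variables in \<open>B\<close>, and a
  product of two nonzero such parts is a nonzero polynomial free of these variables, because
  polynomial rings over fields have no zero divisors.\<close>

lemma primeideal_vars:
  "primeideal (vars_power n B 1 :: 'k::field mpol set) (mpoly_ring n)"
proof (rule primeidealI[OF ideal_vars_power cring_mpoly_ring])
  let ?P = "vars_power n B 1 :: 'k mpol set"
  interpret ideal ?P "mpoly_ring n" by (rule ideal_vars_power)
  have zero_in_P: "0 \<in> ?P" using additive_subgroup.zero_closed[OF is_additive_subgroup] by simp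
  have "1 \<in> carrier (mpoly_ring n :: 'k mpol ring)" "(1 :: 'k mpol) \<notin> ?P"
    by (auto simp: vars_power_def mon_ideal_def carrier_mpoly_ring monomials_def)
  then show "carrier (mpoly_ring n) \<noteq> ?P" by blast
  have split: "\<exists>a0. a0 \<in> carrier (mpoly_ring n) \<and> (\<forall>t\<in>mkeys a0. weight B t = 0)
      \<and> (\<exists>a1\<in>?P. a = a0 + a1)" if a: "a \<in> carrier (mpoly_ring n)" for a :: "'k mpol"
  proof -
    define part where "part F = (\<Sum>t\<in>mkeys a \<inter> F. Poly_Mapping.single t (mlookup a t))" for F
    have lp: "mlookup (part F) t = (if t \<in> F then mlookup a t else 0)" for F t
      by (auto simp: part_def lookup_sum lookup_single when_def in_keys_iff)
    have kp: "mkeys (part F) = mkeys a \<inter> F" for F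
      by (auto simp: in_keys_iff lp split: if_splits)
    let ?F = "{t. weight B t = 0}"
    have "part ?F \<in> carrier (mpoly_ring n)" "\<forall>t\<in>mkeys (part ?F). weight B t = 0"
      using a by (auto simp: kp carrier_mpoly_ring)
    moreover have "part (- ?F) \<in> ?P"
      using a by (auto simp: kp carrier_mpoly_ring vars_power_def mon_ideal_def)
    moreover have "a = part ?F + part (- ?F)"
      by (rule poly_mapping_eqI) (simp add: lookup_add lp)
    ultimately show ?thesis by metis
  qed
  fix a b :: "'k mpol"
  assume a: "a \<in> carrier (mpoly_ring n)" and b: "b \<in> carrier (mpoly_ring n)"
    and "a \<otimes>\<^bsub>mpoly_ring n\<^esub> b \<in> ?P"
  then have ab: "a * b \<in> ?P" by simp
  obtain a0 a1 where A: "a0 \<in> carrier (mpoly_ring n)" "\<forall>t\<in>mkeys a0. weight B t = 0"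
    "a1 \<in> ?P" "a = a0 + a1" using split[OF a] by blast
  obtain b0 b1 where B: "b0 \<in> carrier (mpoly_ring n)" "\<forall>t\<in>mkeys b0. weight B t = 0"
    "b1 \<in> ?P" "b = b0 + b1" using split[OF b] by blast
  define c where "c = a1 * b + a0 * b1"
  have c: "c \<in> ?P"
    using I_r_closed[OF A(3) b] I_l_closed[OF B(3) A(1)] unfolding c_def
    by (simp add: vars_power_def mon_ideal_add)
  have "- 1 \<in> carrier (mpoly_ring n :: 'k mpol ring)"
    by (simp add: carrier_mpoly_ring keys_uminus_field monomials_def)
  from I_l_closed[OF c this] have "- c \<in> ?P" by simp
  with ab have "a * b + (- c) \<in> ?P" unfolding vars_power_def by (rule mon_ideal_add)
  moreover have "a * b + (- c) = a0 * b0" by (simp add: A(4) B(4) c_def distrib_left distrib_right)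
  ultimately have "a0 * b0 \<in> ?P" by (simp only:)
  then have w1: "mkeys (a0 * b0) \<subseteq> {t. 1 \<le> weight B t}"
    unfolding vars_power_def mon_ideal_def by blast
  have "t \<notin> mkeys (a0 * b0)" for t
  proof
    assume t: "t \<in> mkeys (a0 * b0)"
    obtain u w where "t = u + w" "u \<in> mkeys a0" "w \<in> mkeys b0"
      using subsetD[OF keys_mult t] by blast
    then have "weight B t = 0" using A(2) B(2) by (simp add: weight_add)
    then show False using subsetD[OF w1 t] by simp
  qed
  then have "mkeys (a0 * b0) = {}" by blast
  then have "a0 * b0 = 0" by (rule iffD1[OF keys_eq_empty])
  then have "a0 = 0 \<or> b0 = 0" by (rule iffD1[OF mult_eq_0_iff])
  then show "a \<in> ?P \<or> b \<in> ?P"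
  proof
    assume "a0 = 0"
    with A(3,4) have "a \<in> ?P" by (simp only: add_0_left)
    then show ?thesis by (rule disjI1)
  next
    assume "b0 = 0"
    with B(3,4) have "b \<in> ?P" by (simp only: add_0_left)
    then show ?thesis by (rule disjI2)
  qed
qed

lemma split_off_variable:
  assumes "finite B" "Suc q \<le> weight B t" "t \<in> monomials n"
  obtains v u where "v \<in> B" "u \<in> monomials n" "Poly_Mapping.single v 1 \<in> monomials n"
    "t = u + Poly_Mapping.single v 1" "q \<le> weight B u"
proof -
  have "weight B t \<noteq> 0" using assms by simp
  then obtain v where v: "v \<in> B" "mlookup t v \<noteq> 0" unfolding weight_def by (metis sum.neutral)
  define u where "u = t - Poly_Mapping.single v 1"
  have t: "t = u + Poly_Mapping.single v 1"
    using v by (intro poly_mapping_eqI) (auto simp: u_def lookup_add lookup_minus lookup_single when_def)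
  then have "weight B t = weight B u + 1" using v assms(1) by (simp add: weight_add weight_single)
  moreover have "mkeys t = mkeys u \<union> {v}" using arg_cong[OF t, of mkeys] by (simp add: mkeys_mon_add)
  ultimately have "u \<in> monomials n" "Poly_Mapping.single v 1 \<in> monomials n" "q \<le> weight B u"
    using assms by (simp_all add: monomials_def)
  from that[OF v(1) this(1,2) t this(3)] show ?thesis .
qed

text \<open>Weights add under multiplication, which gives one inclusion. For the other, a monomial of weight
  above \<open>q\<close> is a variable from \<open>B\<close> times a monomial of weight at least \<open>q\<close>.\<close>

lemma vars_power_Suc:
  assumes "finite B"
  shows "ideal_prod (mpoly_ring n) (vars_power n B q) (vars_power n B 1)
       = (vars_power n B (Suc q) :: 'k::field mpol set)"
proof
  interpret R: cring "mpoly_ring n :: 'k mpol ring" by (rule cring_mpoly_ring)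
  let ?PP = "ideal_prod (mpoly_ring n) (vars_power n B q) (vars_power n B 1) :: 'k mpol set"
  interpret PP: ideal ?PP "mpoly_ring n" by (rule R.ideal_prod_is_ideal[OF ideal_vars_power ideal_vars_power])
  show "?PP \<subseteq> vars_power n B (Suc q)"
  proof
    fix p assume "p \<in> ?PP"
    then show "p \<in> vars_power n B (Suc q)"
    proof (induction rule: ideal_prod.induct)
      case (prod a b)
      then have a: "a \<in> carrier (mpoly_ring n)" "mkeys a \<subseteq> {t. q \<le> weight B t}"
        and b: "b \<in> carrier (mpoly_ring n)" "mkeys b \<subseteq> {t. 1 \<le> weight B t}"
        unfolding vars_power_def mon_ideal_def by blast+
      have "mkeys (a * b) \<subseteq> {t. Suc q \<le> weight B t}"
      proof
        fix t assume t: "t \<in> mkeys (a * b)"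
        obtain u w where uw: "t = u + w" "u \<in> mkeys a" "w \<in> mkeys b"
          using subsetD[OF keys_mult t] by blast
        then have "q \<le> weight B u" "1 \<le> weight B w" using a b by blast+
        then show "t \<in> {t. Suc q \<le> weight B t}" by (simp add: uw(1) weight_add)
      qed
      then show ?case
        using mult_in_carrier[OF a(1) b(1)]
        unfolding vars_power_def mon_ideal_def mpoly_ring_simps by blast
    next
      case (sum a b)
      from mon_ideal_add[OF sum.IH[unfolded vars_power_def]]
      show ?case unfolding vars_power_def mpoly_ring_simps .
    qed
  qed
  show "vars_power n B (Suc q) \<subseteq> ?PP"
    unfolding vars_power_def[of _ _ "Suc q"]
  proof (rule mon_ideal_subset_ideal[OF PP.is_ideal])
    fix t assume "t \<in> {t. Suc q \<le> weight B t}" "t \<in> monomials n"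
    then have "Suc q \<le> weight B t" "t \<in> monomials n" by simp_all
    from split_off_variable[OF assms this] obtain v u where
      vu: "v \<in> B" "u \<in> monomials n" "Poly_Mapping.single v 1 \<in> monomials n"
        "t = u + Poly_Mapping.single v 1" "q \<le> weight B u" .
    have "1 \<le> weight B (Poly_Mapping.single v 1)" using vu(1)
      by (simp only: weight_single[OF assms] if_True order_refl)
    then have "(mon_poly (Poly_Mapping.single v 1) :: 'k mpol) \<in> vars_power n B 1"
      unfolding vars_power_def mon_poly_in_mon_ideal using vu(3) by blast
    moreover have "(mon_poly u :: 'k mpol) \<in> vars_power n B q"
      unfolding vars_power_def mon_poly_in_mon_ideal using vu(2,5) by blast
    ultimately have "mon_poly u \<otimes>\<^bsub>mpoly_ring n\<^esub> mon_poly (Poly_Mapping.single v 1) \<in> ?PP"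
      by (intro ideal_prod.prod)
    then show "mon_poly t \<in> ?PP"
      unfolding vu(4) mon_poly_def mpoly_ring_simps mult_single by (simp only: mult_1)
  qed
qed

lemma power_vars:
  assumes "finite B"
  shows "vars_power n B 1 [^]\<^bsub>ideals_set (mpoly_ring n)\<^esub> (q::nat)
       = (vars_power n B q :: 'k::field mpol set)"
proof -
  interpret R: cring "mpoly_ring n :: 'k mpol ring" by (rule cring_mpoly_ring)
  interpret I: comm_monoid "ideals_set (mpoly_ring n :: 'k mpol ring)"
    by (rule R.ideals_set_is_comm_monoid)
  have mult: "X \<otimes>\<^bsub>ideals_set (mpoly_ring n)\<^esub> Y = ideal_prod (mpoly_ring n) X Y"
    for X Y :: "'k mpol set" by (simp add: ideals_set_def)
  show ?thesis
  proof (induction q)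
    case 0
    have "\<one>\<^bsub>ideals_set (mpoly_ring n)\<^esub> = (vars_power n B 0 :: 'k mpol set)"
      by (simp add: ideals_set_def vars_power_def mon_ideal_def)
    then show ?case by (simp only: I.nat_pow_0)
  next
    case (Suc q)
    show ?case by (simp only: I.nat_pow_Suc Suc mult vars_power_Suc[OF assms])
  qed
qed

section \<open>Minimal prime decompositions\<close>

text \<open>If no member were contained in \<open>P\<close>, an element of each member outside
  \<open>P\<close> could be chosen, and the product of these would lie in the intersection but not in \<open>P\<close>.\<close>

lemma prime_contains_member:
  assumes "finite \<A>" "\<And>A. A \<in> \<A> \<Longrightarrow> ideal A R" "primeideal P R" "carrier R \<inter> \<Inter>\<A> \<subseteq> P"
  shows "\<exists>A\<in>\<A>. A \<subseteq> P"
proof (rule ccontr)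
  interpret P: primeideal P R by fact
  assume none: "\<not> (\<exists>A\<in>\<A>. A \<subseteq> P)"
  have "\<exists>x\<in>carrier R. x \<in> \<Inter>\<F> \<and> x \<notin> P" if "finite \<F>" "\<F> \<subseteq> \<A>" for \<F>
    using that
  proof (induction \<F>)
    case empty
    have "carrier R \<noteq> P" "P \<subseteq> carrier R" by (rule P.I_notcarr, rule P.a_subset)
    then show ?case by blast
  next
    case (insert A \<F>)
    then obtain x where x: "x \<in> carrier R" "x \<in> \<Inter>\<F>" "x \<notin> P" by blast
    from insert none obtain y where y: "y \<in> A" "y \<notin> P" by blast
    interpret A: ideal A R using insert assms(2) by blast
    have yc: "y \<in> carrier R" using A.Icarr y by blast
    have "x \<otimes>\<^bsub>R\<^esub> y \<in> F" if "F \<in> insert A \<F>" for F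
    proof (cases "F = A")
      case True then show ?thesis using A.I_l_closed x(1) y(1) by simp
    next
      case False
      then have "x \<in> F" "ideal F R" using that x insert assms(2) by blast+
      then show ?thesis using ideal.I_r_closed yc by metis
    qed
    moreover have "x \<otimes>\<^bsub>R\<^esub> y \<notin> P" using P.I_prime x y yc by blast
    ultimately show ?case using x(1) yc by (intro bexI[of _ "x \<otimes>\<^bsub>R\<^esub> y"]) auto
  qed
  from this[OF assms(1)] assms(4) show False by blast
qed

lemma prime_decomp_refines:
  assumes "prime_decomp_of R L \<P>" "prime_decomp_of R L \<Q>" "P \<in> \<P>"
  shows "\<exists>Q\<in>\<Q>. Q \<subseteq> P"
proof (rule prime_contains_member)
  show "carrier R \<inter> \<Inter>\<Q> \<subseteq> P" using assms unfolding prime_decomp_of_def by blast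
qed (use assms in \<open>auto simp: prime_decomp_of_def primeideal_def\<close>)

lemma minimal_prime_decomp_antichain:
  assumes "minimal_prime_decomp_of R L \<P>" "P \<in> \<P>" "P' \<in> \<P>" "P' \<subseteq> P"
  shows "P' = P"
proof (rule ccontr)
  assume "P' \<noteq> P"
  then have "\<Inter>(\<P> - {P}) = \<Inter>\<P>" using assms by blast
  then show False using assms unfolding minimal_prime_decomp_of_def prime_decomp_of_def by metis
qed

text \<open>Each \<open>P\<close> contains some \<open>Q\<close> of the other decomposition, which in turn contains some \<open>P'\<close> of the first;
  irredundance forces \<open>P' = Q = P\<close>. By symmetry two minimal decompositions coincide, which
  determines the description operator in the definition of symbolic powers.\<close>

lemma minimal_prime_decomp_subset:
  assumes "minimal_prime_decomp_of R L \<P>" "minimal_prime_decomp_of R L \<Q>"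
  shows "\<P> \<subseteq> \<Q>"
proof
  fix P assume P: "P \<in> \<P>"
  have d: "prime_decomp_of R L \<P>" "prime_decomp_of R L \<Q>"
    using assms by (auto simp: minimal_prime_decomp_of_def)
  obtain Q where Q: "Q \<in> \<Q>" "Q \<subseteq> P" using prime_decomp_refines[OF d P] by blast
  obtain P' where P': "P' \<in> \<P>" "P' \<subseteq> Q" using prime_decomp_refines[OF d(2,1) Q(1)] by blast
  have "P' = P" using minimal_prime_decomp_antichain[OF assms(1) P P'(1)] P' Q by blast
  then show "P \<in> \<Q>" using P' Q by auto
qed

lemma the_minimal_prime_decomp:
  assumes "minimal_prime_decomp_of R L \<P>"
  shows "(THE \<P>. minimal_prime_decomp_of R L \<P>) = \<P>"
  using assms minimal_prime_decomp_subset by (intro the_equality) blast+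

text \<open>A decomposition of least cardinality inside \<open>\<A>\<close> is irredundant.\<close>

lemma ex_minimal_prime_decomp:
  assumes "prime_decomp_of R L \<A>"
  obtains \<P> where "minimal_prime_decomp_of R L \<P>" "\<P> \<subseteq> \<A>"
proof -
  obtain \<P> where P: "\<P> \<subseteq> \<A> \<and> prime_decomp_of R L \<P>"
    and least: "\<And>\<Q>. card \<Q> < card \<P> \<Longrightarrow> \<not> (\<Q> \<subseteq> \<A> \<and> prime_decomp_of R L \<Q>)"
    using ex_has_least_nat[of "\<lambda>\<Q>. \<Q> \<subseteq> \<A> \<and> prime_decomp_of R L \<Q>" \<A> card] assms
    by (metis linorder_not_le order_refl)
  have "carrier R \<inter> \<Inter>(\<P> - {Q}) \<noteq> L" if "Q \<in> \<P>" for Q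
  proof
    assume "carrier R \<inter> \<Inter>(\<P> - {Q}) = L"
    then have "prime_decomp_of R L (\<P> - {Q})" using P by (auto simp: prime_decomp_of_def)
    moreover have "card (\<P> - {Q}) < card \<P>"
      using that P by (intro card_Diff1_less) (auto simp: prime_decomp_of_def)
    ultimately show False using least P by blast
  qed
  then show ?thesis using that P by (auto simp: minimal_prime_decomp_of_def)
qed

lemma vars_power_subset_imp:
  assumes "B \<subseteq> {1..n}" "vars_power n B 1 \<subseteq> (vars_power n C 1 :: 'k::field mpol set)" "finite C"
  shows "B \<subseteq> C"
proof
  fix v assume v: "v \<in> B"
  have "finite B" using assms(1) finite_subset by blast
  then have "mon_poly (Poly_Mapping.single v 1) \<in> (vars_power n B 1 :: 'k mpol set)"
    using v assms(1) by (auto simp: vars_power_def mon_poly_in_mon_ideal weight_single monomials_def)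
  then have "mon_poly (Poly_Mapping.single v 1) \<in> (vars_power n C 1 :: 'k mpol set)"
    using assms(2) by blast
  then show "v \<in> C" using assms(3)
    by (auto simp: vars_power_def mon_poly_in_mon_ideal weight_single split: if_splits)
qed

section \<open>Symbolic powers of square-free monomial ideals\<close>

definition covering_monomials :: "nat \<Rightarrow> nat set set \<Rightarrow> nat \<Rightarrow> mon set" where
  "covering_monomials n \<B> q = {t \<in> monomials n. \<forall>B\<in>\<B>. q \<le> weight B t}"

lemma absorbing_covering: "absorbing n (covering_monomials n \<B> q)"
  by (auto simp: absorbing_def covering_monomials_def weight_add monomials_add trans_le_add1)

text \<open>The family \<open>\<B>\<close> may be redundant: the minimal decomposition uses a subfamily \<open>\<C>\<close>, but every \<open>B \<in> \<B>\<close>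
  contains some \<open>C \<in> \<C>\<close>, and a weight of at least \<open>q\<close> on \<open>C\<close> gives the same on \<open>B\<close>.\<close>

theorem symbolic_power_eq:
  assumes \<B>: "\<And>B. B \<in> \<B> \<Longrightarrow> B \<subseteq> {1..n}"
  shows "symbolic_power (mpoly_ring n) (mon_ideal n (covering_monomials n \<B> 1)) q
    = (mon_ideal n (covering_monomials n \<B> q) :: 'k::field mpol set)"
proof -
  let ?P = "\<lambda>B. vars_power n B 1 :: 'k mpol set"
  let ?L = "mon_ideal n (covering_monomials n \<B> 1) :: 'k mpol set"
  have finB: "finite B" if "B \<in> \<B>" for B using \<B>[OF that] finite_subset by blast
  have fin: "finite \<B>" using \<B> by (intro finite_subset[of \<B> "Pow {1..n}"]) auto
  have inter: "carrier (mpoly_ring n) \<inter> \<Inter>(?P ` \<B>) = ?L"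
    by (auto simp: vars_power_def mon_ideal_def covering_monomials_def carrier_mpoly_ring)
  have decomp: "prime_decomp_of (mpoly_ring n) ?L (?P ` \<B>)"
    unfolding prime_decomp_of_def
  proof (intro conjI ballI)
    fix Q assume "Q \<in> ?P ` \<B>"
    then obtain B where "Q = ?P B" by (rule imageE)
    then show "primeideal Q (mpoly_ring n)" by (simp only: primeideal_vars)
  qed (rule finite_imageI[OF fin], rule inter)
  then obtain \<P> where \<P>: "minimal_prime_decomp_of (mpoly_ring n) ?L \<P>" "\<P> \<subseteq> ?P ` \<B>"
    by (rule ex_minimal_prime_decomp)
  then obtain \<C> where \<C>: "\<C> \<subseteq> \<B>" "\<P> = ?P ` \<C>" by (metis subset_image_iff)
  have refine: "\<exists>C\<in>\<C>. C \<subseteq> B" if "B \<in> \<B>" for B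
  proof -
    have "\<exists>Q\<in>\<P>. Q \<subseteq> ?P B"
      using decomp \<P>(1) that
      by (intro prime_decomp_refines) (auto simp: minimal_prime_decomp_of_def)
    then obtain C where C: "C \<in> \<C>" "?P C \<subseteq> ?P B" unfolding \<C>(2)
      by (rule bexE) (elim imageE, simp only:)
    have "C \<subseteq> B"
      by (rule vars_power_subset_imp[OF _ C(2) finB[OF that]]) (use C(1) \<C>(1) \<B> in blast)
    then show ?thesis using C(1) by (rule rev_bexI[rotated])
  qed
  have "symbolic_power (mpoly_ring n) ?L q
    = carrier (mpoly_ring n) \<inter> (\<Inter>C\<in>\<C>. ?P C [^]\<^bsub>ideals_set (mpoly_ring n)\<^esub> q)"
    unfolding symbolic_power_def the_minimal_prime_decomp[OF \<P>(1)] \<C>(2) by simp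
  also have "\<dots> = carrier (mpoly_ring n) \<inter> (\<Inter>C\<in>\<C>. vars_power n C q)"
    using \<C>(1) finB power_vars by (intro arg_cong2[of _ _ _ _ "(\<inter>)"] INF_cong refl) blast
  also have "\<dots> = mon_ideal n (covering_monomials n \<C> q)"
    by (auto simp: vars_power_def mon_ideal_def covering_monomials_def carrier_mpoly_ring)
  also have "covering_monomials n \<C> q = covering_monomials n \<B> q"
  proof -
    have mono: "weight C t \<le> weight B t" if "C \<subseteq> B" "B \<in> \<B>" for B C t
      unfolding weight_def using that finB by (intro sum_mono2) auto
    show ?thesis
    proof (intro equalityI subsetI)
      fix t assume t: "t \<in> covering_monomials n \<C> q"
      have "q \<le> weight B t" if B: "B \<in> \<B>" for B
      proof -
        obtain C where C: "C \<in> \<C>" "C \<subseteq> B" using refine[OF B] by blast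
        have "q \<le> weight C t" using t C(1) by (simp add: covering_monomials_def)
        also have "\<dots> \<le> weight B t" by (rule mono[OF C(2) B])
        finally show ?thesis .
      qed
      then show "t \<in> covering_monomials n \<B> q" using t by (simp add: covering_monomials_def)
    qed (use \<C>(1) in \<open>auto simp: covering_monomials_def\<close>)
  qed
  finally show ?thesis .
qed

lemma mon_deg_eq_sum:
  assumes "t \<in> monomials n" shows "mon_deg t = (\<Sum>v = 1..n. mlookup t v)"
  unfolding mon_deg_def using assms
  by (intro sum.mono_neutral_left) (auto simp: monomials_def in_keys_iff)

text \<open>The monomials of the ideal generate it, so their degrees compete in the minimum defining
  \<open>alpha\<close>; and a nonzero homogeneous element of any generating system has a monomial of the ideal of
  the same degree.\<close>

lemma alpha_mon_ideal:
  assumes M: "absorbing n M" "M \<subseteq> monomials n" "M \<noteq> {}"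
  defines "a \<equiv> alpha n (mon_ideal n M :: 'k::field mpol set)"
  shows "\<exists>t\<in>M. mon_deg t = a" and "\<And>t. t \<in> M \<Longrightarrow> a \<le> mon_deg t"
proof -
  let ?J = "mon_ideal n M :: 'k mpol set"
  let ?Q = "\<lambda>d. \<exists>G. homogeneous_generators n ?J G \<and> (\<exists>g \<in> G. homogeneous_of_degree d g)"
  have "genideal (mpoly_ring n) (mon_poly ` M) = ?J"
  proof (rule genideal_monomials[OF M(1)])
    show "\<exists>g\<in>M. \<exists>u\<in>monomials n. t = g + u" if "t \<in> M" for t
      using that by (intro bexI[of _ t] bexI[of _ 0]) (auto simp: monomials_def)
  qed (use M(2) in blast)
  moreover have "mon_poly ` M \<subseteq> carrier (mpoly_ring n) - {0 :: 'k mpol}"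
    using M(2) mon_poly_nonzero by (auto simp: mon_poly_def carrier_mpoly_ring)
  moreover have hom: "homogeneous_of_degree (mon_deg t) (mon_poly t :: 'k mpol)" for t
    by (simp add: homogeneous_of_degree_def mon_poly_def)
  ultimately have hg: "homogeneous_generators n ?J (mon_poly ` M)"
    unfolding homogeneous_generators_def by blast
  have Q: "?Q (mon_deg t)" if "t \<in> M" for t
    using that hg hom by blast
  show "a \<le> mon_deg t" if "t \<in> M" for t
    unfolding a_def alpha_def using Q[OF that] by (rule Least_le)
  obtain t0 where "t0 \<in> M" using M(3) by blast
  have "?Q a" unfolding a_def alpha_def using Q[OF \<open>t0 \<in> M\<close>] by (rule LeastI)
  then obtain G g where G: "homogeneous_generators n ?J G" "g \<in> G" "homogeneous_of_degree a g" by blast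
  interpret cring "mpoly_ring n :: 'k mpol ring" by (rule cring_mpoly_ring)
  have Gc: "G \<subseteq> carrier (mpoly_ring n)" using G(1) by (auto simp: homogeneous_generators_def)
  have "g \<in> ?J" using genideal_self[OF Gc] G by (auto simp: homogeneous_generators_def)
  moreover have "g \<noteq> 0" using G by (auto simp: homogeneous_generators_def)
  then have "mkeys g \<noteq> {}" unfolding keys_eq_empty .
  ultimately obtain t where "t \<in> mkeys g" "t \<in> M" unfolding mon_ideal_def by blast
  then show "\<exists>t\<in>M. mon_deg t = a" using G(3) by (auto simp: homogeneous_of_degree_def)
qed

section \<open>The Waldschmidt constant as a linear program\<close>

definition fractional_cover :: "nat set set \<Rightarrow> (nat \<Rightarrow> real) \<Rightarrow> bool" where
  "fractional_cover \<B> y \<longleftrightarrow> (\<forall>v. 0 \<le> y v) \<and> (\<forall>B\<in>\<B>. 1 \<le> sum y B)"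

text \<open>Dividing the exponents of a monomial of the \<open>q\<close>-th symbolic power by \<open>q\<close> gives a fractional cover,
  hence the lower bound; rounding up the exponents \<open>q y\<^sub>v\<close> gives a monomial of degree at most
  \<open>q \<Sum>y + n\<close>, hence the upper bound.\<close>

theorem waldschmidt_eq_fractional_cover:
  assumes \<B>: "\<And>B. B \<in> \<B> \<Longrightarrow> B \<subseteq> {1..n}"
    and y: "fractional_cover \<B> y"
    and opt: "\<And>z. fractional_cover \<B> z \<Longrightarrow> sum y {1..n} \<le> sum z {1..n}"
  shows "waldschmidt_seq n (mon_ideal n (covering_monomials n \<B> 1) :: 'k::field mpol set)
    \<longlonglongrightarrow> sum y {1..n}"
proof -
  let ?w = "waldschmidt_seq n (mon_ideal n (covering_monomials n \<B> 1) :: 'k mpol set)"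
  let ?V = "sum y {1..n}"
  have bounds: "?V \<le> ?w q \<and> ?w q \<le> ?V + real n / real q" if q: "q > 0" for q
  proof -
    let ?M = "covering_monomials n \<B> q"
    let ?a = "alpha n (mon_ideal n ?M :: 'k mpol set)"
    define t :: mon where "t = (\<Sum>v=1..n. Poly_Mapping.single v (nat \<lceil>real q * y v\<rceil>))"
    have lt: "mlookup t v = (if v \<in> {1..n} then nat \<lceil>real q * y v\<rceil> else 0)" for v
      by (auto simp: t_def lookup_sum lookup_single when_def)
    have y0: "0 \<le> y v" for v using y by (simp add: fractional_cover_def)
    have tm: "t \<in> monomials n" by (auto simp: monomials_def in_keys_iff lt split: if_splits)
    have "q \<le> weight B t" if B: "B \<in> \<B>" for B
    proof -
      have "real q \<le> real q * sum y B" using y B q by (simp add: fractional_cover_def)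
      also have "\<dots> \<le> (\<Sum>v\<in>B. real (mlookup t v))"
        unfolding sum_distrib_left
      proof (rule sum_mono)
        fix v assume "v \<in> B"
        then have "v \<in> {1..n}" using \<B>[OF B] by blast
        then show "real q * y v \<le> real (mlookup t v)" by (simp add: lt real_nat_ceiling_ge)
      qed
      finally show ?thesis by (simp add: weight_def flip: of_nat_sum)
    qed
    then have tM: "t \<in> ?M" using tm by (simp add: covering_monomials_def)
    have sub: "?M \<subseteq> monomials n" by (auto simp: covering_monomials_def)
    have "?M \<noteq> {}" using tM by blast
    note al = alpha_mon_ideal[OF absorbing_covering sub this, where ?'k = 'k]
    have "real ?a \<le> real (mon_deg t)" using al(2)[OF tM] by simp
    also have "\<dots> = (\<Sum>v=1..n. real (nat \<lceil>real q * y v\<rceil>))"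
      by (simp add: mon_deg_eq_sum[OF tm] lt)
    also have "\<dots> \<le> (\<Sum>v=1..n. real q * y v + 1)"
    proof (rule sum_mono)
      fix v
      have "0 \<le> real q * y v" using y0 by simp
      then show "real (nat \<lceil>real q * y v\<rceil>) \<le> real q * y v + 1" by linarith
    qed
    also have "\<dots> = real q * ?V + real n" by (simp add: sum.distrib sum_distrib_left)
    finally have up: "real ?a \<le> real q * ?V + real n" .
    obtain u where u: "u \<in> ?M" "mon_deg u = ?a" using al(1) by blast
    have "fractional_cover \<B> (\<lambda>v. real (mlookup u v) / real q)"
      unfolding fractional_cover_def
    proof (intro conjI ballI allI)
      fix B assume "B \<in> \<B>"
      then have "q \<le> weight B u" using u by (simp add: covering_monomials_def)
      then have "real q \<le> (\<Sum>v\<in>B. real (mlookup u v))" unfolding weight_def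
        by (metis of_nat_le_iff of_nat_sum)
      then show "1 \<le> (\<Sum>v\<in>B. real (mlookup u v) / real q)"
        using q by (simp add: sum_divide_distrib[symmetric])
    qed simp
    from opt[OF this] have "?V \<le> real (mon_deg u) / real q"
      using u sub mon_deg_eq_sum[of u n] by (auto simp: sum_divide_distrib)
    then have lo: "?V \<le> real ?a / real q" using u by simp
    have "symbolic_power (mpoly_ring n) (mon_ideal n (covering_monomials n \<B> 1)) q
        = (mon_ideal n ?M :: 'k mpol set)"
      by (rule symbolic_power_eq) (rule \<B>)
    then have w: "?w q = real ?a / real q" unfolding waldschmidt_seq_def by (rule arg_cong)
    have "real ?a / real q \<le> ?V + real n / real q" using up q by (simp add: field_simps)
    then show ?thesis using lo unfolding w by (rule conjI[rotated])
  qed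
  have "(\<lambda>q. ?V + real n / real q) \<longlonglongrightarrow> ?V + 0"
    by (intro tendsto_add tendsto_const lim_const_over_n)
  then have up: "(\<lambda>q. ?V + real n / real q) \<longlonglongrightarrow> ?V" by simp
  show ?thesis
  proof (rule tendsto_sandwich[OF _ _ tendsto_const up])
    show "\<forall>\<^sub>F q in sequentially. ?V \<le> ?w q"
      using bounds by (intro eventually_sequentiallyI[of 1]) auto
    show "\<forall>\<^sub>F q in sequentially. ?w q \<le> ?V + real n / real q"
      using bounds by (intro eventually_sequentiallyI[of 1]) auto
  qed
qed

section \<open>Borel ideals as intersections of primes\<close>

text \<open>A set has at least \<open>p\<close> elements in \<open>{1..i p}\<close> iff it hits every subset of \<open>{1..i p}\<close> of this
  size. The form \<open>i p + 1 - p\<close> keeps the truncated subtraction exact when \<open>p \<le> i p\<close>.\<close>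

definition hitting_size :: "(nat \<Rightarrow> nat) \<Rightarrow> nat \<Rightarrow> nat" where
  "hitting_size i p = i p + 1 - p"

definition borel_blocks :: "(nat \<Rightarrow> nat) \<Rightarrow> nat \<Rightarrow> nat set set" where
  "borel_blocks i s = {B. \<exists>p\<in>{1..s}. B \<subseteq> {1..i p} \<and> card B = hitting_size i p}"

locale increasing_indices =
  fixes i :: "nat \<Rightarrow> nat" and s :: nat
  assumes s_pos: "1 \<le> s" and first: "1 \<le> i 1" and incr: "strict_mono_on {1..s} i"
begin

lemma shift: "i p + (q - p) \<le> i q" if "1 \<le> p" "p \<le> q" "q \<le> s"
  using that(2,3)
proof (induction q rule: dec_induct)
  case (step q)
  have "i q < i (Suc q)" using incr step that(1) by (auto simp: strict_mono_on_def)
  then show ?case using step by simp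
qed simp

lemma index_le: "p \<le> i p" if "p \<in> {1..s}"
  using shift[of 1 p] that first by auto

lemma mono_le: "i p \<le> i q" if "1 \<le> p" "p \<le> q" "q \<le> s"
  using shift[OF that] by simp

lemma hitting_size_add: "hitting_size i p + p = i p + 1" if "p \<in> {1..s}"
  using index_le[OF that] by (simp add: hitting_size_def)

lemma hitting_size_pos: "0 < hitting_size i p" if "p \<in> {1..s}"
  using hitting_size_add[OF that] index_le[OF that] by linarith

lemma hitting_size_mono: "hitting_size i p \<le> hitting_size i q" if "1 \<le> p" "p \<le> q" "q \<le> s"
  using shift[OF that] that by (simp add: hitting_size_def)

lemma inj: "inj_on i {1..s}"
  using incr by (rule strict_mono_on_imp_inj_on)

end

lemma lookup_sf_mon:
  assumes "inj_on i {1..s}"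
  shows "mlookup (sf_mon i s) v = (if v \<in> i ` {1..s} then 1 else 0)"
proof -
  have "mlookup (sf_mon i s) v = (\<Sum>j = 1..s. if i j = v then 1 else 0)"
    unfolding sf_mon_def lookup_sum lookup_single when_def ..
  also have "\<dots> = card {j\<in>{1..s}. i j = v}" by (simp add: sum.If_cases Int_def)
  also have "\<dots> = (if v \<in> i ` {1..s} then 1 else 0)"
  proof (cases "v \<in> i ` {1..s}")
    case True
    then obtain j where j: "j \<in> {1..s}" "v = i j" by blast
    have "{j'\<in>{1..s}. i j' = v} = {j}" unfolding j(2) using assms j(1) by (blast dest: inj_onD)
    then show ?thesis using True by simp
  next
    case False
    then have "{j\<in>{1..s}. i j = v} = {}" by blast
    then show ?thesis using False by (simp only: card.empty if_False)
  qed
  finally show ?thesis .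
qed

lemma weight_sf_mon:
  assumes "inj_on i {1..s}" "finite C"
  shows "weight C (sf_mon i s) = card (C \<inter> i ` {1..s})"
  using assms(2) by (simp add: weight_def lookup_sf_mon[OF assms(1)] sum.If_cases)

lemma weight_sum_list_single:
  assumes "finite C"
  shows "weight C (\<Sum>p\<leftarrow>ps. Poly_Mapping.single (f p) 1) = length (filter (\<lambda>p. f p \<in> C) ps)"
  by (induction ps) (simp_all add: weight_add weight_single assms)

lemma length_filter_mono:
  "(\<And>x. x \<in> set xs \<Longrightarrow> P x \<Longrightarrow> Q x) \<Longrightarrow> length (filter P xs) \<le> length (filter Q xs)"
  by (induction xs) (auto simp: le_SucI)

text \<open>A move replaces \<open>b\<close> by some \<open>a\<close> with \<open>1 \<le> a < b\<close>, so it cannot take degree away from an initial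
  segment of the variables, and it introduces neither \<open>x\<^sub>0\<close>, which lies outside the ring, nor a
  variable beyond those of \<open>m\<close>.\<close>

lemma borel_move_weight:
  assumes "borel_move m m'"
  shows "weight {1..c} m \<le> weight {1..c} m'"
    and "\<And>v. (\<forall>b. mlookup m b \<noteq> 0 \<longrightarrow> b < v) \<or> v = 0 \<Longrightarrow> mlookup m v = 0 \<Longrightarrow> mlookup m' v = 0"
proof -
  obtain ps where ps: "\<forall>(a, b) \<in> set ps. 1 \<le> a \<and> a < b \<and> 1 \<le> mlookup m b"
    and eq: "m' + (\<Sum>(a, b) \<leftarrow> ps. Poly_Mapping.single b 1) = m + (\<Sum>(a, b) \<leftarrow> ps. Poly_Mapping.single a 1)"
    using assms unfolding borel_move_def by blast
  have eq': "m' + (\<Sum>p \<leftarrow> ps. Poly_Mapping.single (snd p) 1) = m + (\<Sum>p \<leftarrow> ps. Poly_Mapping.single (fst p) 1)"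
    using eq by (simp add: case_prod_beta')
  have w: "weight C m' + length (filter (\<lambda>p. snd p \<in> C) ps) = weight C m + length (filter (\<lambda>p. fst p \<in> C) ps)"
    if "finite C" for C
    using arg_cong[OF eq', of "weight C"] by (simp only: weight_add weight_sum_list_single[OF that])
  have "length (filter (\<lambda>p. snd p \<in> {1..c}) ps) \<le> length (filter (\<lambda>p. fst p \<in> {1..c}) ps)"
    using ps by (intro length_filter_mono) auto
  then show "weight {1..c} m \<le> weight {1..c} m'" using w[of "{1..c}"] by simp
  fix v assume v: "(\<forall>b. mlookup m b \<noteq> 0 \<longrightarrow> b < v) \<or> v = 0" and m0: "mlookup m v = 0"
  have "filter (\<lambda>p. fst p \<in> {v}) ps = []"
  proof -
    have "fst p \<noteq> v" if "p \<in> set ps" for p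
    proof -
      have p: "1 \<le> fst p" "fst p < snd p" "mlookup m (snd p) \<noteq> 0" using ps that by fastforce+
      from v have "snd p < v \<or> v = 0" using p(3) by blast
      then show ?thesis using p(1,2) by linarith
    qed
    then show ?thesis by (simp add: filter_empty_conv)
  qed
  with w[of "{v}"] m0 have "weight {v} m' = 0" by (simp add: weight_def)
  then show "mlookup m' v = 0" by (simp add: weight_def)
qed

text \<open>Replace \<open>i p\<close> by \<open>j p\<close> wherever the two differ.\<close>

lemma sf_mon_borel_move:
  assumes inj: "inj_on i {1..s}" and j: "\<And>p. p \<in> {1..s} \<Longrightarrow> 1 \<le> j p \<and> j p \<le> i p"
  shows "borel_move (sf_mon i s) (sf_mon j s)"
proof -
  let ?xs = "[1..<Suc s]"
  let ?ps = "map (\<lambda>p. (j p, i p)) (filter (\<lambda>p. j p < i p) ?xs)"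
  have sf: "sf_mon f s = (\<Sum>p\<leftarrow>?xs. Poly_Mapping.single (f p) 1)" for f
    by (simp add: sf_mon_def interv_sum_list_conv_sum_set_nat atLeastLessThanSuc_atLeastAtMost del: upt_Suc)
  have "(\<Sum>p\<leftarrow>xs. Poly_Mapping.single (j p) 1)
      + (\<Sum>(a, b)\<leftarrow>map (\<lambda>p. (j p, i p)) (filter (\<lambda>p. j p < i p) xs). Poly_Mapping.single b 1)
    = (\<Sum>p\<leftarrow>xs. Poly_Mapping.single (i p) 1)
      + (\<Sum>(a, b)\<leftarrow>map (\<lambda>p. (j p, i p)) (filter (\<lambda>p. j p < i p) xs). Poly_Mapping.single a (1::nat))"
    if "\<And>p. p \<in> set xs \<Longrightarrow> j p \<le> i p" for xs
    using that
  proof (induction xs)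
    case (Cons x xs)
    then have IH: "(\<Sum>p\<leftarrow>xs. Poly_Mapping.single (j p) 1)
      + (\<Sum>(a, b)\<leftarrow>map (\<lambda>p. (j p, i p)) (filter (\<lambda>p. j p < i p) xs). Poly_Mapping.single b 1)
    = (\<Sum>p\<leftarrow>xs. Poly_Mapping.single (i p) 1)
      + (\<Sum>(a, b)\<leftarrow>map (\<lambda>p. (j p, i p)) (filter (\<lambda>p. j p < i p) xs). Poly_Mapping.single a (1::nat))"
      by simp
    show ?case
    proof (cases "j x < i x")
      case True
      with IH show ?thesis by (simp add: ac_simps)
    next
      case False
      then have "j x = i x" using Cons.prems[of x] by simp
      with IH show ?thesis by (simp add: ac_simps)
    qed
  qed simp
  from this[of ?xs] j have "sf_mon j s + (\<Sum>(a, b)\<leftarrow>?ps. Poly_Mapping.single b 1)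
    = sf_mon i s + (\<Sum>(a, b)\<leftarrow>?ps. Poly_Mapping.single a 1)"
    unfolding sf by (simp del: upt_Suc)
  moreover have "\<forall>(a, b) \<in> set ?ps. 1 \<le> a \<and> a < b \<and> 1 \<le> mlookup (sf_mon i s) b"
    using j by (auto simp: lookup_sf_mon[OF inj])
  ultimately show ?thesis unfolding borel_move_def by blast
qed

text \<open>The \<open>p\<close>-th smallest element of \<open>A\<close> is at most \<open>i p\<close>, since otherwise fewer than \<open>p\<close> elements of \<open>A\<close>
  would be that small.\<close>

lemma sorted_enumeration_below:
  fixes A :: "nat set"
  assumes "finite A" and A: "\<And>p. p \<in> {1..s} \<Longrightarrow> p \<le> card (A \<inter> {..i p})"
  obtains j where "inj_on j {1..s}" "j ` {1..s} \<subseteq> A" "\<And>p. p \<in> {1..s} \<Longrightarrow> j p \<le> i p"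
proof -
  define xs where "xs = sorted_list_of_set A"
  have xs: "set xs = A" "distinct xs" "sorted xs" "length xs = card A"
    using assms(1) by (simp_all add: xs_def)
  have len: "p \<le> length xs" if "p \<in> {1..s}" for p
  proof -
    have "card (A \<inter> {..i p}) \<le> card A" using assms(1) by (intro card_mono) auto
    then show ?thesis using A[OF that] xs(4) by simp
  qed
  define j where "j p = xs ! (p - 1)" for p
  have "inj_on j {1..s}"
  proof (rule inj_onI)
    fix p q assume pq: "p \<in> {1..s}" "q \<in> {1..s}" "j p = j q"
    then have "p - 1 = q - 1" using len[of p] len[of q] xs(2)
      by (subst (asm) j_def, subst (asm) j_def, subst (asm) nth_eq_iff_index_eq) auto
    then show "p = q" using pq by auto
  qed
  moreover have "j ` {1..s} \<subseteq> A"
  proof (rule image_subsetI)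
    fix p assume p: "p \<in> {1..s}"
    then have "p - 1 < length xs" using len[OF p] by auto
    then show "j p \<in> A" unfolding j_def xs(1)[symmetric] by (rule nth_mem)
  qed
  moreover have "j p \<le> i p" if p: "p \<in> {1..s}" for p
  proof (rule ccontr)
    assume large: "\<not> j p \<le> i p"
    have "A \<inter> {..i p} \<subseteq> set (take (p - 1) xs)"
    proof
      fix x assume x: "x \<in> A \<inter> {..i p}"
      then obtain q where q: "q < length xs" "x = xs ! q" using xs(1) by (auto simp: in_set_conv_nth)
      have "q < p - 1"
      proof (rule ccontr)
        assume "\<not> q < p - 1"
        then have "xs ! (p - 1) \<le> xs ! q" using xs(3) q(1) by (intro sorted_nth_mono) auto
        then show False using large x q(2) by (simp add: j_def)
      qed
      then show "x \<in> set (take (p - 1) xs)" using q by (auto simp: in_set_conv_nth)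
    qed
    then have "card (A \<inter> {..i p}) \<le> card (set (take (p - 1) xs))" by (intro card_mono) auto
    also have "\<dots> \<le> p - 1" using card_length[of "take (p - 1) xs"] by simp
    finally show False using A[OF p] p by auto
  qed
  ultimately show ?thesis by (rule that)
qed

text \<open>A square-free Borel move of \<open>m\<close> keeps at least \<open>p\<close> variables with index at most \<open>i p\<close>, so it hits all
  blocks. Conversely, the support of a monomial hitting all blocks contains \<open>p\<close> elements up to \<open>i p\<close>
  for every \<open>p\<close>, and its \<open>s\<close> smallest elements form the support of a square-free Borel move dividing
  the monomial.\<close>

lemma (in increasing_indices) sfBorel_eq_cover_ideal:
  assumes n: "i s \<le> n"
  shows "sfBorel n (sf_mon i s)
    = (mon_ideal n (covering_monomials n (borel_blocks i s) 1) :: 'k::field mpol set)"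
proof -
  let ?M = "covering_monomials n (borel_blocks i s) 1"
  let ?G = "{m'. squarefree_mon m' \<and> borel_move (sf_mon i s) m'}"
  have in_n: "i p \<in> {1..n}" if "p \<in> {1..s}" for p
    using that mono_le[of p s] index_le[OF that] n by auto
  have "?G \<subseteq> ?M \<inter> monomials n"
  proof (rule subsetI)
    fix m' assume "m' \<in> ?G"
    then have sq: "\<And>v. mlookup m' v \<le> 1" and bm: "borel_move (sf_mon i s) m'"
      by (auto simp: squarefree_mon_def)
    have mon: "m' \<in> monomials n"
    proof -
      have zero: "mlookup m' v = 0" if "v \<notin> {1..n}" for v
      proof (rule borel_move_weight(2)[OF bm])
        show "(\<forall>b. mlookup (sf_mon i s) b \<noteq> 0 \<longrightarrow> b < v) \<or> v = 0"
          using that in_n by (fastforce simp: lookup_sf_mon[OF inj] split: if_splits)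
        show "mlookup (sf_mon i s) v = 0" using that in_n by (auto simp: lookup_sf_mon[OF inj])
      qed
      show ?thesis unfolding monomials_def using zero in_keys_iff by blast
    qed
    have "1 \<le> weight B m'" if "B \<in> borel_blocks i s" for B
    proof -
      obtain p where p: "p \<in> {1..s}" "B \<subseteq> {1..i p}" "card B = hitting_size i p"
        using \<open>B \<in> borel_blocks i s\<close> by (auto simp: borel_blocks_def)
      have "i ` {1..p} \<subseteq> {1..i p} \<inter> i ` {1..s}"
        using p(1) mono_le in_n by fastforce
      then have "card (i ` {1..p}) \<le> card ({1..i p} \<inter> i ` {1..s})" by (intro card_mono) auto
      moreover have "card (i ` {1..p}) = p"
        using p(1) inj_on_subset[OF inj, of "{1..p}"] by (simp add: card_image)
      ultimately have "p \<le> weight {1..i p} (sf_mon i s)" by (simp add: weight_sf_mon[OF inj])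
      also have "\<dots> \<le> weight {1..i p} m'" by (rule borel_move_weight(1)[OF bm])
      also have "\<dots> = weight B m' + weight ({1..i p} - B) m'"
        unfolding weight_def using p(2) by (simp add: sum.subset_diff add.commute)
      also have "weight ({1..i p} - B) m' \<le> card ({1..i p} - B)"
        unfolding weight_def using sum_bounded_above[of "{1..i p} - B" "mlookup m'" 1] sq by simp
      also have "card ({1..i p} - B) = i p - card B"
        using p(2) by (simp add: card_Diff_subset finite_subset)
      finally show ?thesis using hitting_size_add[OF p(1)] p(1,3) by auto
    qed
    then show "m' \<in> ?M \<inter> monomials n" using mon by (simp add: covering_monomials_def)
  qed
  moreover have "\<exists>g\<in>?G. \<exists>u\<in>monomials n. t = g + u" if t: "t \<in> ?M" for t
  proof -
    let ?A = "mkeys t"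
    have A: "?A \<subseteq> {1..n}" using t by (simp add: covering_monomials_def monomials_def)
    have "p \<le> card (?A \<inter> {..i p})" if p: "p \<in> {1..s}" for p
    proof (rule ccontr)
      assume few: "\<not> p \<le> card (?A \<inter> {..i p})"
      have "?A \<inter> {..i p} = {1..i p} \<inter> ?A" using A by auto
      then have "card ({1..i p} - ?A) = i p - card (?A \<inter> {..i p})"
        by (simp add: card_Diff_subset_Int)
      then have "hitting_size i p \<le> card ({1..i p} - ?A)"
        using few hitting_size_add[OF p] by simp
      then obtain B where B: "B \<subseteq> {1..i p} - ?A" "card B = hitting_size i p"
        by (meson obtain_subset_with_card_n)
      then have "B \<in> borel_blocks i s" using p by (auto simp: borel_blocks_def)
      then have "1 \<le> weight B t" using t by (simp add: covering_monomials_def)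
      moreover have "weight B t = 0" unfolding weight_def using B(1)
        by (intro sum.neutral) (auto simp: in_keys_iff)
      ultimately show False by simp
    qed
    from sorted_enumeration_below[OF finite_keys this] obtain j where
      j: "inj_on j {1..s}" "j ` {1..s} \<subseteq> ?A" "\<And>p. p \<in> {1..s} \<Longrightarrow> j p \<le> i p" by blast
    let ?g = "sf_mon j s"
    have "squarefree_mon ?g" by (simp add: squarefree_mon_def lookup_sf_mon[OF j(1)])
    moreover have "borel_move (sf_mon i s) ?g"
      using j(2,3) A by (intro sf_mon_borel_move inj) force
    moreover have "t = ?g + (t - ?g)"
    proof (rule poly_mapping_eqI)
      fix v
      have "mlookup ?g v \<le> mlookup t v"
        using j(2) by (auto simp: lookup_sf_mon[OF j(1)] in_keys_iff Suc_le_eq)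
      then show "mlookup t v = mlookup (?g + (t - ?g)) v" by (simp add: lookup_add lookup_minus)
    qed
    moreover have "t - ?g \<in> monomials n"
      using A by (auto simp: monomials_def in_keys_iff lookup_minus)
    ultimately show ?thesis by blast
  qed
  ultimately have "genideal (mpoly_ring n) (mon_poly ` ?G) = (mon_ideal n ?M :: 'k mpol set)"
    by (intro genideal_monomials[OF absorbing_covering])
  moreover have "(mon_poly :: mon \<Rightarrow> 'k mpol) ` ?G = {mon_poly m' |m'. squarefree_mon m' \<and> borel_move (sf_mon i s) m'}"
    by blast
  ultimately show ?thesis unfolding sfBorel_def by (simp only:)
qed

section \<open>Averaging over subsets of fixed size\<close>

text \<open>As long as \<open>A\<close> has at least \<open>c\<close> elements, one of them has value at least \<open>1 / c\<close>; remove such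
  elements until exactly \<open>c\<close> are left.\<close>

lemma average_ge:
  fixes y :: "'a \<Rightarrow> real"
  assumes "finite A" "0 < c" "c \<le> card A" "\<And>B. B \<subseteq> A \<Longrightarrow> card B = c \<Longrightarrow> 1 \<le> sum y B"
  shows "real (card A) / real c \<le> sum y A"
  using assms
proof (induction "card A - c" arbitrary: A)
  case 0
  then show ?case by simp
next
  case (Suc k)
  obtain B where B: "B \<subseteq> A" "card B = c" using Suc.prems(3) by (meson obtain_subset_with_card_n)
  have "\<exists>x\<in>B. 1 / real c \<le> y x"
  proof (rule ccontr)
    assume "\<not> ?thesis"
    then have "sum y B < (\<Sum>x\<in>B. 1 / real c)"
      using B Suc.prems(1,2) by (intro sum_strict_mono) (auto intro: finite_subset)
    also have "\<dots> = 1" using B(2) Suc.prems(2) by simp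
    finally show False using Suc.prems(4)[OF B] by simp
  qed
  then obtain x where x: "x \<in> A" "1 / real c \<le> y x" using B(1) by blast
  have card: "card A = Suc (card (A - {x}))" using card.remove[OF Suc.prems(1) x(1)] .
  have "real (card (A - {x})) / real c \<le> sum y (A - {x})"
  proof (rule Suc.hyps(1))
    show "k = card (A - {x}) - c" "c \<le> card (A - {x})" using Suc.hyps(2) card by simp_all
    show "\<And>B. B \<subseteq> A - {x} \<Longrightarrow> card B = c \<Longrightarrow> 1 \<le> sum y B" using Suc.prems(4) by blast
  qed (use Suc.prems in simp_all)
  moreover have "sum y A = y x + sum y (A - {x})" using Suc.prems(1) x(1) by (rule sum.remove)
  ultimately show ?case using x(2) by (simp add: card add_divide_distrib)
qed

text \<open>Removing an element not above \<open>a\<close> does not destroy an average of at least \<open>a\<close>; if there is no such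
  element, any subset will do.\<close>

lemma subset_keeping_average:
  fixes y :: "'a \<Rightarrow> real"
  assumes "finite A" "k \<le> card A" "real (card A) * a \<le> sum y A"
  shows "\<exists>K\<subseteq>A. card K = k \<and> real k * a \<le> sum y K"
  using assms
proof (induction "card A - k" arbitrary: A)
  case 0
  then show ?case by (intro exI[of _ A]) simp
next
  case (Suc d)
  show ?case
  proof (cases "\<exists>x\<in>A. y x \<le> a")
    case True
    then obtain x where x: "x \<in> A" "y x \<le> a" by blast
    have card: "card A = Suc (card (A - {x}))" using card.remove[OF Suc.prems(1) x(1)] .
    have "sum y A = y x + sum y (A - {x})" using Suc.prems(1) x(1) by (rule sum.remove)
    then have "real (card (A - {x})) * a \<le> sum y (A - {x})"
      using Suc.prems(3) x(2) by (simp add: card algebra_simps)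
    then have "\<exists>K\<subseteq>A - {x}. card K = k \<and> real k * a \<le> sum y K"
      using Suc.hyps(2) Suc.prems(1) card by (intro Suc.hyps(1)) simp_all
    then show ?thesis by blast
  next
    case False
    obtain K where K: "K \<subseteq> A" "card K = k" using Suc.prems(2) by (meson obtain_subset_with_card_n)
    have "(\<Sum>x\<in>K. a) \<le> sum y K" using False K(1) by (intro sum_mono) force
    then show ?thesis using K by auto
  qed
qed

section \<open>The optimal cover\<close>

lemma sum_split_at:
  fixes f :: "nat \<Rightarrow> real"
  assumes "a \<le> b"
  shows "sum f {1..b} = sum f {1..a} + sum f {a<..b}"
proof -
  have "{1..b} = {1..a} \<union> {a<..b}" using assms by auto
  then show ?thesis by (simp only:) (rule sum.union_disjoint, auto)
qed

text \<open>The combinatorial data of the linear program: \<open>v 0, \<dots>, v (r - 1)\<close> are the entries of \<open>T'(m)\<close> and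
  \<open>w\<close> is \<open>t\<^sub>l\<close>. The assumption \<open>jump\<close> is what makes each step contain a whole block;
  \<open>s \<le> i w\<close> reflects that \<open>T'(m)\<close> cannot be prolonged by \<open>w\<close>; \<open>binding\<close> says that each constraint
  is implied by one at some \<open>v j\<close> or at an index from \<open>w\<close> on.\<close>

locale borel_staircase = increasing_indices +
  fixes v :: "nat \<Rightarrow> nat" and r w :: nat
  assumes r_pos: "0 < r"
    and step: "\<And>j. j < r \<Longrightarrow> v j \<in> {1..s} \<and> i (v j) < s"
    and jump: "\<And>j. Suc j < r \<Longrightarrow> i (v j) < v (Suc j)"
    and top: "w \<in> {1..s}" "i (v (r - 1)) < w" "s \<le> i w"
    and binding: "\<And>p. p \<in> {1..s} \<Longrightarrow> \<exists>t\<in>{1..s}. p \<le> t \<and> i t + p = i p + t \<and>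
        ((\<exists>j<r. t = v j) \<or> w \<le> t)"
begin

text \<open>The optimal cover is a step function with \<open>r + 1\<close> steps: step \<open>j\<close> ends at \<open>edge j\<close> and has the
  height \<open>1 / width j\<close>. Steps \<open>0, \<dots>, r - 1\<close> belong to the \<open>v j\<close>, the last one to \<open>w\<close>. The last edge
  is as small as the constraint at \<open>s\<close> permits: up to \<open>i s - edge r\<close> of the \<open>i s - s + 1\<close>
  elements of a block for \<open>s\<close> may lie at height zero, which leaves \<open>width r\<close> elements, just enough
  for a mass of \<open>1\<close>.\<close>

definition width :: "nat \<Rightarrow> nat" where
  "width j = hitting_size i (if j < r then v j else w)"

definition edge :: "nat \<Rightarrow> nat" where
  "edge j = (if j < r then i (v j) else s + hitting_size i w - 1)"

definition height :: "nat \<Rightarrow> real" where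
  "height x = (if x \<in> {1..edge r} then 1 / width (LEAST j. x \<le> edge j) else 0)"

text \<open>The mass of the steps \<open>0, \<dots>, J\<close> of the staircase.\<close>

definition area :: "nat \<Rightarrow> real" where
  "area J = edge 0 / width 0 + (\<Sum>j = 1..J. (real (edge j) - real (edge (j - 1))) / width j)"

lemma width_pos: "0 < width j"
  using hitting_size_pos step top(1) by (simp add: width_def)

lemma edge_mono_Suc: "j < r \<Longrightarrow> edge j \<le> edge (Suc j)"
proof (cases "Suc j < r")
  case True
  then have "i (v j) < v (Suc j)" "v (Suc j) \<in> {1..s}" using jump step by blast+
  then show ?thesis using True index_le[of "v (Suc j)"] by (simp add: edge_def)
next
  case False
  moreover assume "j < r"
  moreover have "i (v j) < s" using step \<open>j < r\<close> by blast
  ultimately show ?thesis using hitting_size_pos[OF top(1)] by (simp add: edge_def)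
qed

lemma edge_mono: "a \<le> b \<Longrightarrow> b \<le> r \<Longrightarrow> edge a \<le> edge b"
proof (induction b rule: dec_induct)
  case (step b)
  then show ?case using edge_mono_Suc[of b] by simp
qed simp

lemma width_mono_Suc: "j < r \<Longrightarrow> width j \<le> width (Suc j)"
proof (cases "Suc j < r")
  case True
  then have "i (v j) < v (Suc j)" "v (Suc j) \<in> {1..s}" "v j \<in> {1..s}"
    using jump[of j] step[of j] step[of "Suc j"] by auto
  then show ?thesis using True index_le[of "v j"] hitting_size_mono[of "v j" "v (Suc j)"]
    by (simp add: width_def)
next
  case False
  moreover assume "j < r"
  ultimately have "Suc j = r" by simp
  then have "j = r - 1" by simp
  have "v j \<in> {1..s}" using step \<open>j < r\<close> by blast
  then have "v j \<le> w" using index_le[of "v j"] top(2) \<open>j = r - 1\<close> by simp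
  then show ?thesis using \<open>v j \<in> {1..s}\<close> \<open>j < r\<close> False hitting_size_mono[of "v j" w] top(1)
    by (simp add: width_def)
qed

lemma width_mono: "a \<le> b \<Longrightarrow> b \<le> r \<Longrightarrow> width a \<le> width b"
proof (induction b rule: dec_induct)
  case (step b)
  then show ?case using width_mono_Suc[of b] by simp
qed simp

lemma edge_last: "edge r + 1 = s + hitting_size i w" "edge r \<le> i s"
  using s_pos hitting_size_pos[OF top(1)] hitting_size_mono[of w s] hitting_size_add[of s] top(1)
  by (auto simp: edge_def)

lemma height_eq:
  assumes "J \<le> r" "x \<le> edge J" "J = 0 \<or> edge (J - 1) < x" "1 \<le> x"
  shows "height x = 1 / width J"
proof -
  have "(LEAST j. x \<le> edge j) = J"
  proof (rule Least_equality)
    fix j assume "x \<le> edge j"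
    show "J \<le> j"
    proof (rule ccontr)
      assume "\<not> J \<le> j"
      then have "edge j \<le> edge (J - 1)" using assms(1) by (intro edge_mono) auto
      then show False using \<open>x \<le> edge j\<close> assms(3) \<open>\<not> J \<le> j\<close> by simp
    qed
  qed (rule assms(2))
  moreover have "x \<le> edge r" using assms(2) edge_mono[OF assms(1)] by simp
  ultimately show ?thesis using assms(4) by (simp add: height_def)
qed

lemma height_ge:
  assumes "J \<le> r" "x \<in> {1..edge J}"
  shows "1 / width J \<le> height x"
proof -
  let ?j = "LEAST j. x \<le> edge j"
  have "?j \<le> J" using assms(2) by (intro Least_le) simp
  then have "width ?j \<le> width J" using assms(1) by (rule width_mono)
  then have "1 / real (width J) \<le> 1 / real (width ?j)"
    using width_pos[of ?j] by (intro divide_left_mono) auto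
  moreover have "x \<le> edge r" using assms edge_mono[OF assms(1)] by simp
  ultimately show ?thesis using assms(2) by (simp add: height_def)
qed

lemma height_nonneg: "0 \<le> height x"
  by (simp add: height_def)

lemma sum_height: "J \<le> r \<Longrightarrow> sum height {1..edge J} = area J"
proof (induction J)
  case 0
  have "sum height {1..edge 0} = (\<Sum>x\<in>{1..edge 0}. 1 / width 0)"
    by (intro sum.cong refl height_eq) auto
  then show ?case by (simp add: area_def)
next
  case (Suc J)
  have le: "edge J \<le> edge (Suc J)" using Suc.prems by (intro edge_mono) auto
  then have "sum height {1..edge (Suc J)}
      = sum height {1..edge J} + sum height {edge J<..edge (Suc J)}"
    by (rule sum_split_at)
  also have "sum height {edge J<..edge (Suc J)} = (\<Sum>x\<in>{edge J<..edge (Suc J)}. 1 / width (Suc J))"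
    using Suc.prems by (intro sum.cong refl height_eq) auto
  finally show ?case using Suc le by (simp add: area_def of_nat_diff)
qed

text \<open>Since the heights decrease, a block with at least \<open>width J\<close> elements up to \<open>edge J\<close> has mass at
  least \<open>1\<close>. For blocks of \<open>v j\<close> take \<open>J = j\<close>. A block of some \<open>t \<ge> w\<close> has at most
  \<open>i t - edge r\<close> elements beyond the last edge, and
  \<open>(i t - t + 1) - (i t - edge r) = (s - t) + width r\<close>, so \<open>J = r\<close> works.\<close>

lemma height_fractional_cover: "fractional_cover (borel_blocks i s) height"
  unfolding fractional_cover_def
proof (intro conjI allI ballI height_nonneg)
  fix B assume "B \<in> borel_blocks i s"
  then obtain p where p: "p \<in> {1..s}" "B \<subseteq> {1..i p}" "card B = hitting_size i p"
    by (auto simp: borel_blocks_def)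
  obtain t where t: "t \<in> {1..s}" "p \<le> t" "i t + p = i p + t" "(\<exists>j<r. t = v j) \<or> w \<le> t"
    using binding[OF p(1)] by blast
  have B: "B \<subseteq> {1..i t}" "card B = hitting_size i t"
    using p t(2,3) hitting_size_add[OF p(1)] hitting_size_add[OF t(1)] by auto
  have fin: "finite B" using B(1) finite_subset by blast
  have enough: "1 \<le> sum height B" if J: "J \<le> r" "width J \<le> card (B \<inter> {1..edge J})" for J
  proof -
    have "1 \<le> real (card (B \<inter> {1..edge J})) * (1 / width J)"
      using J(2) width_pos[of J] by (simp add: field_simps)
    also have "\<dots> = (\<Sum>x\<in>B \<inter> {1..edge J}. 1 / width J)" by simp
    also have "\<dots> \<le> sum height (B \<inter> {1..edge J})"
      using J(1) by (intro sum_mono height_ge) auto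
    also have "\<dots> \<le> sum height B"
      using fin height_nonneg by (intro sum_mono2) auto
    finally show ?thesis .
  qed
  from t(4) show "1 \<le> sum height B"
  proof
    assume "\<exists>j<r. t = v j"
    then obtain j where j: "j < r" "t = v j" by blast
    have "B \<inter> {1..edge j} = B" using B(1) j by (auto simp: edge_def)
    then show ?thesis using j B(2) by (intro enough[of j]) (simp_all add: width_def)
  next
    assume "w \<le> t"
    have "B - {1..edge r} \<subseteq> {edge r<..i t}" using B(1) by auto
    then have "card (B - {1..edge r}) \<le> card {edge r<..i t}" by (intro card_mono) auto
    then have "card B \<le> card (B \<inter> {1..edge r}) + (i t - edge r)"
      using fin card_Int_Diff[of B "{1..edge r}"] by simp
    moreover have "hitting_size i w \<le> hitting_size i t"
      using \<open>w \<le> t\<close> t(1) top(1) by (intro hitting_size_mono) auto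
    ultimately have "hitting_size i w \<le> card (B \<inter> {1..edge r})"
      using B(2) edge_last(1) hitting_size_add[OF t(1)] t(1) by auto
    then show ?thesis by (intro enough[of r]) (simp_all add: width_def)
  qed
qed

lemma cover_avg:
  assumes z: "fractional_cover (borel_blocks i s) z"
    and p: "p \<in> {1..s}" and A: "A \<subseteq> {1..i p}" "hitting_size i p \<le> card A"
  shows "real (card A) / real (hitting_size i p) \<le> sum z A"
proof (rule average_ge)
  show "finite A" using A(1) finite_subset by blast
  fix B assume "B \<subseteq> A" "card B = hitting_size i p"
  then have "B \<in> borel_blocks i s" unfolding borel_blocks_def using p A(1) by blast
  then show "1 \<le> sum z B" using z by (simp add: fractional_cover_def)
qed (use A hitting_size_pos[OF p] in auto)

text \<open>The step from \<open>i (v J)\<close> to \<open>i (v (Suc J))\<close> has \<open>i (v (Suc J)) - i (v J)\<close> elements, and as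
  \<open>i (v J) < v (Suc J)\<close> this is at least the size of a block for \<open>v (Suc J)\<close>, so the averaging bound
  applies to it.\<close>

lemma area_le_partial_cover:
  assumes z: "fractional_cover (borel_blocks i s) z"
  shows "J < r \<Longrightarrow> area J \<le> sum z {1..edge J}"
proof (induction J)
  case 0
  have v0: "v 0 \<in> {1..s}" using step[OF r_pos] by blast
  have "hitting_size i (v 0) \<le> i (v 0)" using hitting_size_add[OF v0] v0 by simp
  then have "real (card {1..i (v 0)}) / real (hitting_size i (v 0)) \<le> sum z {1..i (v 0)}"
    by (intro cover_avg[OF z v0]) auto
  then show ?case using r_pos by (simp add: area_def edge_def width_def)
next
  case (Suc J)
  let ?t = "v (Suc J)" and ?A = "{i (v J)<..i (v (Suc J))}"
  have t: "?t \<in> {1..s}" using step Suc.prems by blast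
  have lt: "i (v J) < ?t" using jump Suc.prems by blast
  have "hitting_size i ?t \<le> card ?A"
    using hitting_size_add[OF t] lt by simp
  then have "real (card ?A) / real (hitting_size i ?t) \<le> sum z ?A"
    by (intro cover_avg[OF z t]) auto
  moreover have le: "i (v J) \<le> i ?t" using lt index_le[OF t] by simp
  ultimately have "(real (edge (Suc J)) - real (edge J)) / width (Suc J) \<le> sum z ?A"
    using Suc.prems by (simp add: edge_def width_def of_nat_diff)
  moreover have "sum z {1..i ?t} = sum z {1..i (v J)} + sum z ?A"
    using le by (rule sum_split_at)
  moreover have "area (Suc J)
      = area J + (real (edge (Suc J)) - real (edge J)) / width (Suc J)"
    by (simp add: area_def)
  ultimately show ?case using Suc by (simp add: edge_def)
qed

lemma area_top:
  "area r = area (r - 1) + (real (edge r) - real (i (v (r - 1)))) / hitting_size i w"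
proof -
  have "{1..r} = insert r {1..r - 1}" using r_pos by auto
  then show ?thesis using r_pos by (simp add: area_def edge_def width_def)
qed

text \<open>The last step may extend beyond \<open>i w\<close>, where the constraint at \<open>w\<close> says nothing, so this constraint is
  combined with the one at \<open>s\<close>. After the last \<open>i (v j)\<close> the mass is found in two disjoint sets: a heavy
  \<open>K\<close> up to \<open>i w\<close>, and its complement up to \<open>i s\<close>, which is a block for \<open>s\<close> by the choice of the size
  of \<open>K\<close>.\<close>

lemma area_le_cover:
  assumes z: "fractional_cover (borel_blocks i s) z"
  shows "area r \<le> sum z {1..i s}"
proof -
  let ?e = "i (v (r - 1))" and ?c = "hitting_size i w"
  let ?D = "{?e<..i w}"
  have e: "?e < s" using step[of "r - 1"] r_pos by simp
  have iw: "i w \<le> i s" using mono_le[of w s] top(1) by simp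
  have "?c \<le> card ?D" using hitting_size_add[OF top(1)] top(2) by simp
  then have "real (card ?D) / real ?c \<le> sum z ?D"
    by (intro cover_avg[OF z top(1)]) auto
  moreover have "s - 1 - ?e \<le> card ?D" using top(3) by simp
  ultimately obtain K where K: "K \<subseteq> ?D" "card K = s - 1 - ?e"
    "real (s - 1 - ?e) * (1 / real ?c) \<le> sum z K"
    using subset_keeping_average[of ?D "s - 1 - ?e" "1 / real ?c" z] by auto
  let ?B = "{?e<..i s} - K"
  have Ksub: "K \<subseteq> {?e<..i s}" using K(1) iw by auto
  have "card ?B = hitting_size i s"
    using Ksub K(2) e index_le[of s] s_pos by (simp add: card_Diff_subset finite_subset hitting_size_def)
  then have "?B \<in> borel_blocks i s"
    unfolding borel_blocks_def using s_pos by (auto intro!: bexI[of _ s])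
  then have "1 \<le> sum z ?B" using z by (simp add: fractional_cover_def)
  moreover have "sum z {?e<..i s} = sum z ?B + sum z K"
    using Ksub by (intro sum.subset_diff) auto
  moreover have "area (r - 1) \<le> sum z {1..?e}"
    using area_le_partial_cover[OF z, of "r - 1"] r_pos by (simp add: edge_def)
  moreover have "sum z {1..i s} = sum z {1..?e} + sum z {?e<..i s}"
    using e index_le[of s] s_pos by (intro sum_split_at) simp
  moreover note area_top
  moreover have "(real (edge r) - real ?e) / real ?c = 1 + real (s - 1 - ?e) * (1 / real ?c)"
    using edge_last(1) e hitting_size_pos[OF top(1)] by (simp add: field_simps of_nat_diff)
  ultimately show ?thesis using K(3) by linarith
qed

lemma area_last:
  "area r = 1 + (real s - real (i (v (r - 1))) - 1) / hitting_size i w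
     + i (v 0) / hitting_size i (v 0)
     + (\<Sum>j = 1..r - 1. (real (i (v j)) - real (i (v (j - 1)))) / hitting_size i (v j))"
proof -
  have "(real (edge r) - real (i (v (r - 1)))) / hitting_size i w
      = 1 + (real s - real (i (v (r - 1))) - 1) / hitting_size i w"
    using edge_last(1) hitting_size_pos[OF top(1)] by (simp add: field_simps)
  moreover have "(\<Sum>j = 1..r - 1. (real (edge j) - real (edge (j - 1))) / width j)
    = (\<Sum>j = 1..r - 1. (real (i (v j)) - real (i (v (j - 1)))) / hitting_size i (v j))"
    by (intro sum.cong refl) (auto simp: edge_def width_def)
  then have "area (r - 1) = i (v 0) / hitting_size i (v 0)
     + (\<Sum>j = 1..r - 1. (real (i (v j)) - real (i (v (j - 1)))) / hitting_size i (v j))"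
    using r_pos by (simp add: area_def edge_def width_def)
  ultimately show ?thesis unfolding area_top by linarith
qed

theorem waldschmidt_seq_sfBorel:
  assumes "i s \<le> n"
  shows "waldschmidt_seq n (sfBorel n (sf_mon i s) :: 'k::field mpol set) \<longlonglongrightarrow> area r"
proof -
  have blocks: "B \<subseteq> {1..n}" if "B \<in> borel_blocks i s" for B
    using that mono_le[of _ s] assms by (fastforce simp: borel_blocks_def)
  have total: "sum height {1..n} = area r"
  proof -
    have "sum height {1..edge r} = sum height {1..n}"
      using edge_last(2) assms by (intro sum.mono_neutral_left) (auto simp: height_def)
    then show ?thesis using sum_height[of r] by simp
  qed
  have "sum height {1..n} \<le> sum z {1..n}" if z: "fractional_cover (borel_blocks i s) z" for z
  proof -
    have "area r \<le> sum z {1..i s}" by (rule area_le_cover[OF z])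
    also have "\<dots> \<le> sum z {1..n}"
      using z assms by (intro sum_mono2) (auto simp: fractional_cover_def)
    finally show ?thesis by (simp only: total)
  qed
  from waldschmidt_eq_fractional_cover[OF blocks height_fractional_cover this]
  show ?thesis unfolding sfBorel_eq_cover_ideal[OF assms] total .
qed

end

section \<open>The tuples of a square-free monomial\<close>

context increasing_indices
begin

lemma finite_T_cand: "finite (T_cand i t)"
  by (rule finite_subset[of _ "{..<t}"]) (auto simp: T_cand_def)

lemma T_entry_Suc_in: "T_cand i (T_entry i s q) \<noteq> {} \<Longrightarrow> T_entry i s (Suc q) \<in> T_cand i (T_entry i s q)"
  using Max_in[OF finite_T_cand] by simp

lemma T_last_empty: "T_cand i (T_entry i s (T_last i s)) = {}"
proof -
  have "\<exists>q. T_cand i (T_entry i s q) = {}"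
  proof (rule ccontr)
    assume none: "\<not> ?thesis"
    have "T_entry i s q + q \<le> s" for q
    proof (induction q)
      case (Suc q)
      have "T_entry i s (Suc q) \<in> T_cand i (T_entry i s q)" using none T_entry_Suc_in by blast
      then have "T_entry i s (Suc q) < T_entry i s q" by (simp add: T_cand_def)
      then show ?case using Suc by linarith
    qed simp
    from this[of "Suc s"] show False by simp
  qed
  then show ?thesis unfolding T_last_def by (rule LeastI_ex)
qed

lemma T_entry_step:
  assumes "q < T_last i s"
  shows "1 \<le> T_entry i s (Suc q)" "T_entry i s (Suc q) < T_entry i s q"
proof -
  have "T_cand i (T_entry i s q) \<noteq> {}" using assms not_less_Least unfolding T_last_def by blast
  from T_entry_Suc_in[OF this] show "1 \<le> T_entry i s (Suc q)" "T_entry i s (Suc q) < T_entry i s q" by (auto simp: T_cand_def)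
qed

lemma T_entry_antimono: "q \<le> q' \<Longrightarrow> q' \<le> T_last i s \<Longrightarrow> T_entry i s q' + (q' - q) \<le> T_entry i s q"
proof (induction q' rule: dec_induct)
  case (step q')
  then have "T_entry i s q' + (q' - q) \<le> T_entry i s q" "T_entry i s (Suc q') < T_entry i s q'" using T_entry_step(2)[of q'] by auto
  then show ?case using step.hyps by simp
qed simp

lemma T_entry_range: "q \<le> T_last i s \<Longrightarrow> T_entry i s q \<in> {1..s}"
  using s_pos T_entry_antimono[of 0 q] T_entry_step(1)[of "q - 1"] by (cases q) auto

text \<open>The smallest entry of \<open>T(m)\<close> from \<open>p\<close> on works: a gap between \<open>p\<close> and this entry would give an entry
  in between.\<close>

lemma T_entry_covers:
  assumes p: "p \<in> {1..s}"
  shows "\<exists>q\<le>T_last i s. p \<le> T_entry i s q \<and> i (T_entry i s q) + p = i p + T_entry i s q"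
proof -
  let ?Q = "{q. q \<le> T_last i s \<and> p \<le> T_entry i s q}"
  define q where "q = Max ?Q"
  have fin: "finite ?Q" by simp
  have "0 \<in> ?Q" using p by simp
  then have "q \<in> ?Q" unfolding q_def using Max_in[OF fin] by blast
  then have q: "q \<le> T_last i s" "p \<le> T_entry i s q" by auto
  have max: "q' \<le> q" if "q' \<in> ?Q" for q' unfolding q_def using Max_ge[OF fin that] .
  have le_s: "T_entry i s q \<le> s" using T_entry_range[OF q(1)] by simp
  have consec: "i (Suc x) = Suc (i x)" if x: "p \<le> x" "x < T_entry i s q" for x
  proof (rule ccontr)
    assume gap: "i (Suc x) \<noteq> Suc (i x)"
    have "i x < i (Suc x)" using shift[of x "Suc x"] x p le_s by simp
    then have "x \<in> T_cand i (T_entry i s q)" using gap x p by (simp add: T_cand_def)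
    then have "q < T_last i s" using T_last_empty q(1) by (metis empty_iff le_neq_implies_less)
    have "x \<le> T_entry i s (Suc q)" using Max_ge[OF finite_T_cand \<open>x \<in> T_cand i (T_entry i s q)\<close>] by simp
    then have "Suc q \<in> ?Q" using \<open>q < T_last i s\<close> x(1) by simp
    then show False using max by fastforce
  qed
  have "i x + p = i p + x" if "p \<le> x" "x \<le> T_entry i s q" for x
    using that
  proof (induction x rule: dec_induct)
    case (step x)
    then show ?case using consec[of x] by simp
  qed simp
  then show ?thesis using q by blast
qed

lemma set_T_list: "set (T_list i s) = T_entry i s ` {0..T_last i s}"
  by (auto simp: T_list_def atLeast0LessThan atLeast0AtMost lessThan_Suc_atMost simp del: upt_Suc)

lemma finite_T'_cand: "finite (T'_cand i s t)"
  by (rule finite_subset[of _ "set (T_list i s)"]) (auto simp: T'_cand_def)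

lemma T'_entry_Suc_in: "T'_cand i s (T'_entry i s j) \<noteq> {} \<Longrightarrow> T'_entry i s (Suc j) \<in> T'_cand i s (T'_entry i s j)"
  using Min_in[OF finite_T'_cand] by simp

lemma T'_cand_range: "t \<in> T'_cand i s t' \<Longrightarrow> t \<in> {1..s}"
  using T_entry_range by (auto simp: T'_cand_def set_T_list)

text \<open>The entries strictly increase, because \<open>t \<le> i t\<close>, and are at most \<open>s\<close>, so the construction stops.\<close>

lemma T'_last_empty: "T'_cand i s (T'_entry i s (T'_length i s - 1)) = {}"
proof -
  have "\<exists>j. T'_cand i s (T'_entry i s j) = {}"
  proof (rule ccontr)
    assume none: "\<not> ?thesis"
    then have nxt: "T'_entry i s (Suc j) \<in> T'_cand i s (T'_entry i s j)" for j using T'_entry_Suc_in by blast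
    have range: "T'_entry i s j \<in> {1..s}" for j
      using nxt T'_cand_range T_entry_range[of "T_last i s"] by (cases j) auto
    have "j \<le> T'_entry i s j" for j
    proof (induction j)
      case (Suc j)
      have "i (T'_entry i s j) < T'_entry i s (Suc j)" using nxt[of j] by (simp add: T'_cand_def)
      then show ?case using Suc index_le[OF range[of j]] by linarith
    qed simp
    from this[of "Suc s"] range[of "Suc s"] show False by simp
  qed
  then show ?thesis unfolding T'_length_def by simp (rule LeastI_ex)
qed

lemma T'_entry_step:
  assumes "Suc j < T'_length i s"
  shows "T'_entry i s (Suc j) \<in> T'_cand i s (T'_entry i s j)"
proof -
  have "j < (LEAST j. T'_cand i s (T'_entry i s j) = {})" using assms by (simp add: T'_length_def)
  then have "T'_cand i s (T'_entry i s j) \<noteq> {}" by (rule not_less_Least)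
  then show ?thesis by (rule T'_entry_Suc_in)
qed

lemma T'_entry_facts:
  assumes "i (T_entry i s (T_last i s)) < s" "j < T'_length i s"
  shows "T'_entry i s j \<in> {1..s} \<and> i (T'_entry i s j) < s"
proof (cases j)
  case 0
  then show ?thesis using assms T_entry_range[of "T_last i s"] by simp
next
  case (Suc j')
  then have "T'_entry i s j \<in> T'_cand i s (T'_entry i s j')" using T'_entry_step assms(2) by blast
  then show ?thesis using T'_cand_range s_pos by (auto simp: T'_cand_def)
qed

text \<open>The list of \<open>T(m)\<close> runs from \<open>t\<^sub>k\<close> down to \<open>t\<^sub>0\<close>, so its entry number \<open>j\<close>, counted from \<open>0\<close>, is
  \<open>t\<close> at \<open>k - j\<close>.\<close>

lemma truncation_entries:
  assumes "prefix (T'_list i s) (T_list i s)" "j < T'_length i s"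
  shows "j \<le> T_last i s" "T'_entry i s j = T_entry i s (T_last i s - j)"
proof -
  have len: "length (T'_list i s) = T'_length i s" "length (T_list i s) = Suc (T_last i s)"
    by (simp_all add: T'_list_def T_list_def)
  then have "T'_length i s \<le> Suc (T_last i s)" using prefix_length_le[OF assms(1)] by simp
  then show j: "j \<le> T_last i s" using assms(2) by simp
  have "T'_entry i s j = T'_list i s ! j" using assms(2) by (simp add: T'_list_def)
  also have "\<dots> = T_list i s ! j"
    using assms len by (auto simp: prefix_def nth_append)
  also have "\<dots> = T_entry i s (T_last i s - j)" using j by (simp add: T_list_def rev_nth del: upt_Suc)
  finally show "T'_entry i s j = T_entry i s (T_last i s - j)" .
qed

end

section \<open>The Waldschmidt constant of a Borel ideal\<close>

theorem corollary5p3: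
  fixes n s k r l :: nat
    and i t u :: "nat \<Rightarrow> nat"
    and I :: "'k::field mpol set"
  assumes "1 \<le> s" and "1 \<le> i 1" and "strict_mono_on {1..s} i" and "i s \<le> n"
    and "k = T_last i s" and "t = T_entry i s"
    and "r = T'_length i s" and "u = T'_rev_entry i s"
    and "i (t k) < s"
    and "l = Max {q \<in> {0..k}. i (u 1) + 1 \<le> t q}"
    and "I = sfBorel n (sf_mon i s)"
    and "prefix (T'_list i s) (T_list i s)"
    and "\<not> (\<exists>p \<in> {0..k}. u 1 < t p \<and> t p < t l)"
  shows "convergent (waldschmidt_seq n I) \<and>
    waldschmidt n I =
      1 + (real s - real (i (u 1)) - 1) / (real (i (t l)) - real (t l) + 1)
        + real (i (t k)) / (real (i (t k)) - real (t k) + 1)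
        + (\<Sum>j = 1..r - 1. (real (i (u j)) - real (i (u (j + 1))))
                              / (real (i (u j)) - real (u j) + 1))"
proof -
  interpret increasing_indices i s
    by unfold_locales (fact assms)+
  let ?v = "T'_entry i s" and ?h = "hitting_size i"
  have u: "u j = ?v (r - j)" for j
    by (simp add: assms T'_rev_entry_def)
  have r_pos: "0 < r" by (simp add: assms T'_length_def)
  have v: "?v j \<in> {1..s} \<and> i (?v j) < s" if "j < r" for j
    using T'_entry_facts[of j] that assms by blast
  have v0: "?v 0 = t k" by (simp add: \<open>t = _\<close> \<open>k = _\<close>)
  have u1: "u 1 \<in> {1..s}" "i (u 1) < s" using v[of "r - 1"] r_pos u by auto

  have fin: "finite {q \<in> {0..k}. i (u 1) + 1 \<le> t q}" by simp
  have "0 \<in> {q \<in> {0..k}. i (u 1) + 1 \<le> t q}" using u1(2) assms by simp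
  then have "l \<in> {q \<in> {0..k}. i (u 1) + 1 \<le> t q}"
    unfolding \<open>l = _\<close> using Max_in[OF fin] by blast
  then have l: "l \<le> k" "i (u 1) < t l" by auto
  then have tl: "t l \<in> {1..s}" using T_entry_range[of l] assms by blast
  \<comment> \<open>Otherwise \<open>t l\<close> would qualify as a further entry of \<open>T'(m)\<close>.\<close>
  have il: "s \<le> i (t l)"
  proof (rule ccontr)
    assume "\<not> s \<le> i (t l)"
    then have "t l \<in> T'_cand i s (u 1)"
      using l assms by (auto simp: T'_cand_def set_T_list)
    then show False using T'_last_empty u[of 1] assms by simp
  qed
  have binding: "\<exists>x\<in>{1..s}. p \<le> x \<and> i x + p = i p + x \<and> ((\<exists>j<r. x = ?v j) \<or> t l \<le> x)"
    if p: "p \<in> {1..s}" for p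
  proof -
    obtain q where q: "q \<le> k" "p \<le> t q" "i (t q) + p = i p + t q"
      using T_entry_covers[OF p] assms by blast
    \<comment> \<open>By truncation the entries of \<open>T(m)\<close> up to \<open>u 1\<close> are those of \<open>T'(m)\<close>, and none lies strictly
      between \<open>u 1\<close> and \<open>t l\<close>.\<close>
    have "(\<exists>j<r. t q = ?v j) \<or> t l \<le> t q"
    proof (cases "k - q < r")
      case True
      then have "?v (k - q) = t q"
        using truncation_entries(2)[of "k - q"] q(1) assms by simp
      then show ?thesis using True by metis
    next
      case False
      have "u 1 = t (k - (r - 1))"
        using truncation_entries(2)[of "r - 1"] r_pos u[of 1] assms by simp
      moreover have "q < k - (r - 1)" using False r_pos by linarith
      then have "t (k - (r - 1)) < t q"
        using T_entry_antimono[of q "k - (r - 1)"] \<open>k = _\<close> \<open>t = _\<close> by simp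
      ultimately have "\<not> t q < t l" using assms(13) q(1) by auto
      then show ?thesis by simp
    qed
    then show ?thesis using q T_entry_range[of q] assms by blast
  qed
  interpret borel_staircase i s ?v r "t l"
  proof unfold_locales
    show "i (?v j) < ?v (Suc j)" if "Suc j < r" for j
      using T'_entry_step[of j] that assms by (simp add: T'_cand_def)
    show "i (?v (r - 1)) < t l" using l(2) u[of 1] by simp
  qed (use r_pos v tl il binding in blast)+

  have h: "real (?h p) = real (i p) - real p + 1" if "p \<in> {1..s}" for p
    using hitting_size_add[OF that] by linarith
  have "(\<Sum>j = 1..r - 1. (real (i (?v j)) - real (i (?v (j - 1)))) / ?h (?v j))
    = (\<Sum>j = 1..r - 1. (real (i (u j)) - real (i (u (j + 1)))) / (real (i (u j)) - real (u j) + 1))"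
  proof (rule sum.reindex_bij_witness[of _ "\<lambda>j. r - j" "\<lambda>j. r - j"])
    fix j assume "j \<in> {1..r - 1}"
    then have j: "1 \<le> j" "j < r" using r_pos by auto
    then have "u (r - j) = ?v j" "u (r - j + 1) = ?v (j - 1)" unfolding u by simp_all
    then show "(real (i (u (r - j))) - real (i (u (r - j + 1)))) / (real (i (u (r - j))) - real (u (r - j)) + 1)
      = (real (i (?v j)) - real (i (?v (j - 1)))) / ?h (?v j)"
      using h v[OF j(2)] by simp
  qed auto
  moreover have "t k \<in> {1..s}" using v[OF r_pos] unfolding v0 by blast
  moreover have "?v (r - 1) = u 1" by (simp add: u)
  ultimately have "area r = 1 + (real s - real (i (u 1)) - 1) / (real (i (t l)) - real (t l) + 1)
        + real (i (t k)) / (real (i (t k)) - real (t k) + 1)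
        + (\<Sum>j = 1..r - 1. (real (i (u j)) - real (i (u (j + 1))))
                              / (real (i (u j)) - real (u j) + 1))"
    unfolding area_last by (simp only: v0 h tl)
  moreover have "waldschmidt_seq n I \<longlonglongrightarrow> area r"
    unfolding \<open>I = _\<close> using \<open>i s \<le> n\<close> by (rule waldschmidt_seq_sfBorel)
  ultimately show ?thesis
    unfolding waldschmidt_def by (auto intro: convergentI limI)
qed

end
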